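(* Let $C=p_r\dots p_s$ be a configuration of g-2PATH with free left hand that satisfies the condition of noninterference of extensions (CNI). When $-r\le s$, let $j_0$ be the minimal integer $j$ with $0\le j\le s$ such that $-r+g(r,j)\le j+1$. Then \[\mathrm{mft}_{\text{g-2PATH}}(C)=\begin{cases}-2r+s & \text{if } -r>s,\\ -r+2j_0+1 & \text{if } -r\le s \text{ and } -r+g(r,j_0)=j_0+1,\\ -r+2j_0 & \text{if } -r\le s \text{ and } -r+g(r,j_0)<j_0+1.\end{cases}\]
   Context: Positions are elements of $\mathbb{Z}^2$; with $\epsilon_0=(1,0),\epsilon_1=(0,1),\epsilon_2=(-1,0),\epsilon_3=(0,-1)$, positions $p,p'$ are adjacent if $p'-p$ is some $\epsilon_i$. A configuration of g-2PATH is a sequence $C=p_r\dots p_s$ ($r\le0\le s$) of positions with $p_0=(0,0)$ (the general), consecutive positions adjacent, all positions distinct, and $p_l,p_m$ not adjacent whenever $|l-m|\ge2$. For $p\in C$, $\mathrm{bc}_C(p)=(b_0,\dots,b_3)$ with $b_i=1$ iff $p+\epsilon_i\in C$. Firing squad model (boundary-sensitive): a finite automaton $A$ has a finite state set with quiescent state $\mathrm{Q}$, general states $\mathrm{G}_0,\dots,\mathrm{G}_{m-1}$, firing states $\mathcal F\not\ni\mathrm{Q}$, a map $\tau:\{0,1\}^4\to\{0,\dots,m-1\}$ and a transition function from the current state and the four neighbour states ($\#$ where no node), with $\mathrm{Q}$ stable when all inputs are in $\{\mathrm{Q},\#\}$. On $C$, at time $0$ node $(0,0)$ is in $\mathrm{G}_{\tau(\mathrm{bc}_C((0,0)))}$,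 others in $\mathrm{Q}$, synchronous updates. $A$ is a solution of g-2PATH if for every configuration $C$ there is $t_C$ with no node in $\mathcal F$ before $t_C$ and all nodes in $\mathcal F$ at $t_C=:\mathrm{ft}(C,A)$. $\mathrm{mft}_{\text{g-2PATH}}(C)=\min_A\mathrm{ft}(C,A)$ over solutions. For $r\le i\le0\le j\le s$: $W(i,j)$ is the set of pairs $(x_0,x_1)$ of finite, possibly empty, sequences of positions such that $x_0p_i\dots p_jx_1$ is a configuration $C'$ of g-2PATH (general at $p_0$) with $\mathrm{bc}_{C'}(p_l)=\mathrm{bc}_C(p_l)$ for $i\le l\le j$; $U(i,j)$, $V(i,j)$ are the sets of first, resp. second, components of its elements; $f(i,j)=\sup\{|x_0|:x_0\in U(i,j)\}$, $g(i,j)=\sup\{|x_1|:x_1\in V(i,j)\}$ ($|x|$ = number of positions; possibly $\infty$). $\mathrm{NI}(i,j)$ means $W(i,j)=U(i,j)\times V(i,j)$. $I=\{(i,j): r\le i-1,\ W(i,j)$ infinite, $W(i-1,j)$ finite$\}$, $J=\{(i,j): j+1\le s,\ W(i,j)$ infinite, $W(i,j+1)$ finite$\}$, $K=\{(i,j): W(i,j)$ finite$\}$. $C$ satisfies CNI if $\mathrm{NI}(i,j)$ holds for all $(i,j)\in I\cup J\cup K$. The left hand of $C$ is free if $r=0$ or ($r<0$ and $f(r+1,s)=\infty$). *)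

theory Defs
  imports Main "HOL-Library.Extended_Nat"
begin

type_synonym position = "int \<times> int"

definition padd :: "position \<Rightarrow> position \<Rightarrow> position" where
  "padd p q = (fst p + fst q, snd p + snd q)"

definition eps :: "nat \<Rightarrow> position" where
  "eps i = (if i = 0 then (1,0) else if i = 1 then (0,1) else if i = 2 then (-1,0) else (0,-1))"

definition adjacent :: "position \<Rightarrow> position \<Rightarrow> bool" where
  "adjacent p q \<longleftrightarrow> (\<exists>i<4. q = padd p (eps i))"

text \<open>A configuration p_r ... p_s is represented by its index bounds r (lo), s (hi) and the
  map l \<mapsto> p_l (only its values on {r..s} matter).\<close>
record config =
  lo :: int
  hi :: int
  pos :: "int \<Rightarrow> position"

definition is_config :: "config \<Rightarrow> bool" where
  "is_config C \<longleftrightarrow>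
     lo C \<le> 0 \<and> 0 \<le> hi C \<and> pos C 0 = (0,0) \<and>
     (\<forall>l. lo C \<le> l \<and> l < hi C \<longrightarrow> adjacent (pos C l) (pos C (l+1))) \<and>
     inj_on (pos C) {lo C..hi C} \<and>
     (\<forall>l\<in>{lo C..hi C}. \<forall>m\<in>{lo C..hi C}. \<bar>l - m\<bar> \<ge> 2 \<longrightarrow> \<not> adjacent (pos C l) (pos C m))"

definition cells :: "config \<Rightarrow> position set" where
  "cells C = pos C ` {lo C..hi C}"

type_synonym bcode = "bool \<times> bool \<times> bool \<times> bool"

definition bc :: "position set \<Rightarrow> position \<Rightarrow> bcode" where
  "bc P p = (padd p (eps 0) \<in> P, padd p (eps 1) \<in> P, padd p (eps 2) \<in> P, padd p (eps 3) \<in> P)"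

text \<open>States are natural numbers (any finite automaton is isomorphic to one whose state set
  is a finite set of naturals). The neighbour inputs are given in the order of directions
  eps 0 .. eps 3; None stands for the border symbol #.\<close>
record automaton =
  states :: "nat set"
  quiescent :: nat
  ngen :: nat
  gen :: "nat \<Rightarrow> nat"
  firing :: "nat set"
  tau :: "bcode \<Rightarrow> nat"
  delta :: "nat \<Rightarrow> nat option \<Rightarrow> nat option \<Rightarrow> nat option \<Rightarrow> nat option \<Rightarrow> nat"

definition is_automaton :: "automaton \<Rightarrow> bool" where
  "is_automaton A \<longleftrightarrow>
     finite (states A) \<and> quiescent A \<in> states A \<and>
     (\<forall>k < ngen A. gen A k \<in> states A) \<and>
     firing A \<subseteq> states A \<and> quiescent A \<notin> firing A \<and>
     (\<forall>b. tau A b < ngen A) \<and>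
     (\<forall>x\<in>states A. \<forall>a\<in>insert None (Some ` states A). \<forall>b\<in>insert None (Some ` states A).
        \<forall>c\<in>insert None (Some ` states A). \<forall>d\<in>insert None (Some ` states A).
        delta A x a b c d \<in> states A) \<and>
     (\<forall>a\<in>{None, Some (quiescent A)}. \<forall>b\<in>{None, Some (quiescent A)}.
        \<forall>c\<in>{None, Some (quiescent A)}. \<forall>d\<in>{None, Some (quiescent A)}.
        delta A (quiescent A) a b c d = quiescent A)"

definition nbr :: "position set \<Rightarrow> (position \<Rightarrow> nat) \<Rightarrow> position \<Rightarrow> nat \<Rightarrow> nat option" where
  "nbr P st q i = (if padd q (eps i) \<in> P then Some (st (padd q (eps i))) else None)"

fun run :: "automaton \<Rightarrow> position set \<Rightarrow> nat \<Rightarrow> position \<Rightarrow> nat" where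
  "run A P 0 = (\<lambda>q. if q = (0,0) then gen A (tau A (bc P (0,0))) else quiescent A)"
| "run A P (Suc t) = (\<lambda>q. delta A (run A P t q)
      (nbr P (run A P t) q 0) (nbr P (run A P t) q 1) (nbr P (run A P t) q 2) (nbr P (run A P t) q 3))"

definition fires_at :: "automaton \<Rightarrow> config \<Rightarrow> nat \<Rightarrow> bool" where
  "fires_at A C t \<longleftrightarrow>
     (\<forall>q\<in>cells C. run A (cells C) t q \<in> firing A) \<and>
     (\<forall>t'<t. \<forall>q\<in>cells C. run A (cells C) t' q \<notin> firing A)"

definition is_solution :: "automaton \<Rightarrow> bool" where
  "is_solution A \<longleftrightarrow> is_automaton A \<and> (\<forall>C. is_config C \<longrightarrow> (\<exists>t. fires_at A C t))"

definition ft :: "config \<Rightarrow> automaton \<Rightarrow> nat" where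
  "ft C A = (THE t. fires_at A C t)"

definition mft :: "config \<Rightarrow> nat" where
  "mft C = Inf {ft C A | A. is_solution A}"

text \<open>The sequence x0 p_i ... p_j x1, indexed so that p_l keeps index l (general at p_0).\<close>
definition extend :: "config \<Rightarrow> int \<Rightarrow> int \<Rightarrow> position list \<Rightarrow> position list \<Rightarrow> config" where
  "extend C i j x0 x1 =
     \<lparr> lo = i - int (length x0), hi = j + int (length x1),
       pos = (\<lambda>l. if l < i then x0 ! nat (l - (i - int (length x0)))
                  else if l \<le> j then pos C l
                  else x1 ! nat (l - j - 1)) \<rparr>"

definition W :: "config \<Rightarrow> int \<Rightarrow> int \<Rightarrow> (position list \<times> position list) set" where
  "W C i j = {(x0, x1). is_config (extend C i j x0 x1) \<and>
       (\<forall>l\<in>{i..j}. bc (cells (extend C i j x0 x1)) (pos C l) = bc (cells C) (pos C l))}"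

definition U :: "config \<Rightarrow> int \<Rightarrow> int \<Rightarrow> position list set" where
  "U C i j = fst ` W C i j"

definition V :: "config \<Rightarrow> int \<Rightarrow> int \<Rightarrow> position list set" where
  "V C i j = snd ` W C i j"

definition f :: "config \<Rightarrow> int \<Rightarrow> int \<Rightarrow> enat" where
  "f C i j = (SUP x\<in>U C i j. enat (length x))"

definition g :: "config \<Rightarrow> int \<Rightarrow> int \<Rightarrow> enat" where
  "g C i j = (SUP x\<in>V C i j. enat (length x))"

definition NI :: "config \<Rightarrow> int \<Rightarrow> int \<Rightarrow> bool" where
  "NI C i j \<longleftrightarrow> W C i j = U C i j \<times> V C i j"

definition in_range :: "config \<Rightarrow> int \<Rightarrow> int \<Rightarrow> bool" where
  "in_range C i j \<longleftrightarrow> lo C \<le> i \<and> i \<le> 0 \<and> 0 \<le> j \<and> j \<le> hi C"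

definition Iset :: "config \<Rightarrow> (int \<times> int) set" where
  "Iset C = {(i, j). in_range C i j \<and> lo C \<le> i - 1 \<and> infinite (W C i j) \<and> finite (W C (i - 1) j)}"

definition Jset :: "config \<Rightarrow> (int \<times> int) set" where
  "Jset C = {(i, j). in_range C i j \<and> j + 1 \<le> hi C \<and> infinite (W C i j) \<and> finite (W C i (j + 1))}"

definition Kset :: "config \<Rightarrow> (int \<times> int) set" where
  "Kset C = {(i, j). in_range C i j \<and> finite (W C i j)}"

definition CNI :: "config \<Rightarrow> bool" where
  "CNI C \<longleftrightarrow> (\<forall>(i, j)\<in>Iset C \<union> Jset C \<union> Kset C. NI C i j)"

definition free_left_hand :: "config \<Rightarrow> bool" where
  "free_left_hand C \<longleftrightarrow> lo C = 0 \<or> (lo C < 0 \<and> f C (lo C + 1) (hi C) = \<infinity>)"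

end

theory Submission
  imports Defs
begin

text \<open>
  \<^bold>\<open>Existence of a solution.\<close> The directed edges of a path with at least two nodes form a ring,
  and every node can host the virtual cells of its outgoing edges. On a ring with one wall, each wall
  sends signals of speed \<open>1\<close> and \<open>1/2\<close> in both directions. If all gaps between walls have length
  \<open>L\<close> (or \<open>1\<close>), then after \<open>L\<close> steps the fast signals reach the opposite walls at the very moment
  when the slow ones meet in the middle; all old and new walls restart simultaneously with gaps
  \<open>L div 2\<close>. When every cell is a wall, all cells fire.

  \<^bold>\<open>Upper bound.\<close> In parallel to any solution, let the nodes exchange the facts \<open>(p, bc p)\<close> together
  with a clock up to time \<open>T\<close>, and fire at time \<open>T\<close> if the facts of \<open>p\<^sub>r \<dots> p\<^sub>j\<close> are known. A configuration
  with these facts is \<open>p\<^sub>r \<dots> p\<^sub>j x\<^sub>1\<close> with \<open>|x\<^sub>1| \<le> g(r,j)\<close>, so if \<open>T\<close> is large enough all its nodes know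
  them by time \<open>T\<close>.

  \<^bold>\<open>Lower bound.\<close> If \<open>p\<^sub>r\<close> does not see beyond \<open>p\<^sub>j\<close> by time \<open>T\<close>, then firing \<open>C\<close> by time \<open>T\<close> entails
  firing \<open>p\<^sub>r \<dots> p\<^sub>j x\<^sub>1\<close> at the same time. If the right end of the latter does not see \<open>p\<^sub>r\<close>,
  then \<open>x\<^sub>0 p\<^sub>r\<^sub>+\<^sub>1 \<dots> p\<^sub>j x\<^sub>1\<close> fires at that time too, for every \<open>x\<^sub>0\<close> compatible with \<open>x\<^sub>1\<close>. By noninterference
  and freeness of the left hand there are arbitrarily long such \<open>x\<^sub>0\<close>, whose far end is still quiescent
  at time \<open>T\<close>.
\<close>

section \<open>Synchronization of a ring\<close>

text \<open>In \<open>Wall b\<close>, \<open>b\<close> marks a wall that has just (re)started. In \<open>Sig fr fl sr sl\<close> the flags tell whether a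
  fast signal moving right, left is present, and \<open>sr\<close>, \<open>sl\<close> hold the phase of a slow signal moving
  right, left: it rests in its cell at phase \<open>False\<close> and moves on at phase \<open>True\<close>.\<close>
datatype vstate = Wall bool | Sig bool bool "bool option" "bool option" | Fire

abbreviation blank :: vstate where "blank \<equiv> Sig False False None None"

fun fast_r :: "vstate \<Rightarrow> bool" where
  "fast_r (Wall b) = b" | "fast_r (Sig a b c d) = a" | "fast_r Fire = False"
fun fast_l :: "vstate \<Rightarrow> bool" where
  "fast_l (Wall b) = b" | "fast_l (Sig a b c d) = b" | "fast_l Fire = False"
fun slow_r :: "vstate \<Rightarrow> bool option" where
  "slow_r (Wall b) = (if b then Some True else None)" | "slow_r (Sig a b c d) = c" | "slow_r Fire = None"
fun slow_l :: "vstate \<Rightarrow> bool option" where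
  "slow_l (Wall b) = (if b then Some True else None)" | "slow_l (Sig a b c d) = d" | "slow_l Fire = None"

definition slow_next :: "bool option \<Rightarrow> bool option \<Rightarrow> bool option" where
  "slow_next behind here = (if here = Some False then Some True
     else if behind = Some True then Some False else None)"

fun ring_rule :: "vstate \<Rightarrow> vstate \<Rightarrow> vstate \<Rightarrow> vstate" where
  "ring_rule l Fire r = Fire"
| "ring_rule l (Wall b) r =
     (if b then (if l = Wall True \<and> r = Wall True then Fire else Wall False)
      else Wall (fast_r l \<or> fast_l r))"
| "ring_rule l (Sig fr fl sr sl) r =
     (if sr = Some False \<and> sl = Some False
        \<or> sr = Some True \<and> slow_l r = Some True
        \<or> sl = Some True \<and> slow_r l = Some True
      then Wall True
      else Sig (fast_r l) (fast_l r) (slow_next (slow_r l) sr) (slow_next (slow_l r) sl))"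

text \<open>\<open>d k\<close> is the distance from cell \<open>k\<close> to the nearest wall on its left (or at \<open>k\<close>). Adjacent walls
  come in isolated pairs, which arise whenever an odd gap is halved.\<close>
definition good_gaps :: "nat \<Rightarrow> (int \<Rightarrow> nat) \<Rightarrow> bool" where
  "good_gaps L d \<longleftrightarrow> (\<forall>k. d k < L \<and> (d (k+1) = 0 \<or> d (k+1) = d k + 1)
     \<and> (1 \<le> d k \<and> d k + 1 < L \<longrightarrow> d (k+1) = d k + 1)
     \<and> (2 \<le> L \<longrightarrow> \<not> (d (k-1) = 0 \<and> d k = 0 \<and> d (k+1) = 0)))"

text \<open>State of the ring \<open>t\<close> steps after all walls restarted together. A slow
  signal has then moved \<open>(t+1) div 2\<close> cells and is about to move on iff
  \<open>t\<close> is even. For \<open>d k > 0\<close> the next wall on the right is at distance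
  \<open>L - d k\<close>.\<close>

definition stage :: "nat \<Rightarrow> (int \<Rightarrow> nat) \<Rightarrow> nat \<Rightarrow> int \<Rightarrow> vstate" where
  "stage L d t k = (if d k = 0 then Wall (t = 0)
     else Sig (d k = t) (L - d k = t)
       (if d k = (t+1) div 2 then Some (even t) else None)
       (if L - d k = (t+1) div 2 then Some (even t) else None))"

text \<open>Distances after every gap of length \<open>L >= 2\<close> is cut in the middle: an even
  gap gets one wall at \<open>L div 2\<close> (the second branch is empty), an odd gap two adjacent
  walls at \<open>L div 2\<close> and \<open>L div 2 + 1\<close>.\<close>

definition halve :: "nat \<Rightarrow> nat \<Rightarrow> nat" where
  "halve L x = (if x < L div 2 then x else if x < L - L div 2 then 0 else x - (L - L div 2))"

lemma halve_cases:
  assumes "2 \<le> L"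
  obtains h where "h \<ge> 1" "L = 2*h" "L div 2 = h" "\<And>x. halve L x = (if x < h then x else x - h)"
  | h where "h \<ge> 1" "L = 2*h+1" "L div 2 = h"
      "\<And>x. halve L x = (if x < h then x else if x = h then 0 else x - (h+1))"
proof (cases "even L")
  case True
  then obtain h where "L = 2*h" by (elim evenE)
  then show thesis using assms by (intro that(1)[of h]) (auto simp: halve_def)
next
  case False
  then obtain h where "L = 2*h+1" by (elim oddE)
  then show thesis using assms by (intro that(2)[of h]) (auto simp: halve_def)
qed

lemma halve_less: "2 \<le> L \<Longrightarrow> x < L \<Longrightarrow> halve L x < L div 2"
  by (erule halve_cases) (simp_all, auto)

lemma halve_step:
  assumes "2 \<le> L" "x < L" "n = 0 \<or> n = x + 1" "1 \<le> x \<and> x + 1 < L \<longrightarrow> n = x + 1" "n < L"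
  shows "(halve L n = 0 \<or> halve L n = halve L x + 1)
     \<and> (1 \<le> halve L x \<and> halve L x + 1 < L div 2 \<longrightarrow> halve L n = halve L x + 1)"
  using assms(1)
proof (cases rule: halve_cases)
  case (1 h)
  then show ?thesis using assms by (cases "n = 0"; cases "x < h") auto
next
  case (2 h)
  then show ?thesis using assms by (cases "n = 0"; cases "x < h"; cases "x = h") auto
qed

text \<open>Two adjacent walls after halving are either an old pair or the two middle walls of an
  odd gap; in both cases the next cell has new distance 1, since the new gaps have length at least
  2.\<close>

lemma halve_zeros:
  assumes "2 \<le> L div 2" "w < L" "x = 0 \<or> x = w + 1" "1 \<le> w \<and> w + 1 < L \<longrightarrow> x = w + 1"
    "n = 0 \<or> n = x + 1" "1 \<le> x \<and> x + 1 < L \<longrightarrow> n = x + 1" "\<not> (w = 0 \<and> x = 0 \<and> n = 0)"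
    "halve L w = 0" "halve L x = 0"
  shows "halve L n \<noteq> 0"
proof -
  have "2 \<le> L" using assms(1) by simp
  then show ?thesis
  proof (cases rule: halve_cases)
    case (1 h)
    have w: "w = 0 \<or> w = h" using assms(8) assms(2) 1 by (auto split: if_splits)
    have x: "x = 0 \<or> x = h" using assms(9,2,3) 1 by (auto split: if_splits)
    from w x assms 1 show ?thesis by (elim disjE) auto
  next
    case (2 h)
    have w: "w = 0 \<or> w = h \<or> w = h+1" using assms(8) assms(2) 2 by (auto split: if_splits)
    have x: "x = 0 \<or> x = h \<or> x = h+1" using assms(9,2,3) 2 by (auto split: if_splits)
    from w x assms 2 show ?thesis by (elim disjE) auto
  qed
qed

lemma good_gaps_at:
  assumes "good_gaps L d" "2 \<le> L"
  obtains "d (k-1) < L" "d k < L" "d (k+1) < L"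
    "d (k+1) = 0 \<or> d (k+1) = d k + 1" "d k = 0 \<or> d k = d (k-1) + 1"
    "1 \<le> d k \<and> d k + 1 < L \<longrightarrow> d (k+1) = d k + 1"
    "1 \<le> d (k-1) \<and> d (k-1) + 1 < L \<longrightarrow> d k = d (k-1) + 1"
    "\<not> (d (k-1) = 0 \<and> d k = 0 \<and> d (k+1) = 0)"
proof -
  have a: "d j < L \<and> (d (j+1) = 0 \<or> d (j+1) = d j + 1) \<and> (1 \<le> d j \<and> d j + 1 < L \<longrightarrow> d (j+1) = d j + 1)
     \<and> \<not> (d (j-1) = 0 \<and> d j = 0 \<and> d (j+1) = 0)" for j
    using assms unfolding good_gaps_def by blast
  show thesis using a[of k] a[of "k-1"] a[of "k+1"] by (intro that) simp_all
qed

lemma good_gaps_halve: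
  assumes "good_gaps L d" "2 \<le> L"
  shows "good_gaps (L div 2) (\<lambda>k. halve L (d k))"
  unfolding good_gaps_def
proof (intro allI)
  fix k
  obtain h: "d (k-1) < L" "d k < L" "d (k+1) < L"
    "d (k+1) = 0 \<or> d (k+1) = d k + 1" "d k = 0 \<or> d k = d (k-1) + 1"
    "1 \<le> d k \<and> d k + 1 < L \<longrightarrow> d (k+1) = d k + 1"
    "1 \<le> d (k-1) \<and> d (k-1) + 1 < L \<longrightarrow> d k = d (k-1) + 1"
    "\<not> (d (k-1) = 0 \<and> d k = 0 \<and> d (k+1) = 0)"
    using good_gaps_at[OF assms] by metis
  show "halve L (d k) < L div 2
     \<and> (halve L (d (k+1)) = 0 \<or> halve L (d (k+1)) = halve L (d k) + 1)
     \<and> (1 \<le> halve L (d k) \<and> halve L (d k) + 1 < L div 2 \<longrightarrow> halve L (d (k+1)) = halve L (d k) + 1)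
     \<and> (2 \<le> L div 2 \<longrightarrow> \<not> (halve L (d (k-1)) = 0 \<and> halve L (d k) = 0 \<and> halve L (d (k+1)) = 0))"
    using halve_less[OF assms(2) h(2)] halve_step[OF assms(2) h(2,4,6,3)]
      halve_zeros[OF _ h(1,5,7,4,6,8)] by blast
qed

section \<open>The ring rule applied to stages\<close>

lemma signals_stage:
  "fast_r (stage L d t k) \<longleftrightarrow> d k = t"
  "slow_r (stage L d t k) = Some True \<longleftrightarrow> even t \<and> d k = t div 2"
  unfolding stage_def by (auto elim: evenE)

text \<open>Here \<open>x\<close> is the distance of the left neighbour of \<open>k\<close>; the
  second hypothesis covers both an inner cell \<open>k\<close> and the wall that closes the
  gap.\<close>

lemma signals_stage_l:
  assumes "x < L" "d k = (if x + 1 < L then x + 1 else 0)"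
  shows "fast_l (stage L d t k) \<longleftrightarrow> L - x = t + 1"
    "slow_l (stage L d t k) = Some True \<longleftrightarrow> even t \<and> L - x = t div 2 + 1"
  using assms unfolding stage_def by (auto elim: evenE)

text \<open>At \<open>t = 0\<close> the wall does not fire, because adjacent walls come in isolated
  pairs. Later it hears a fast signal exactly when one has crossed a whole gap, and on at least one
  side it borders such a gap.\<close>

lemma stage_step_wall:
  assumes "good_gaps L d" "2 \<le> L" "d k = 0"
  shows "ring_rule (stage L d t (k-1)) (stage L d t k) (stage L d t (k+1)) =
    Wall (t > 0 \<and> t + 1 = L)"
proof -
  obtain h: "d (k-1) < L" "d (k+1) = 0 \<or> d (k+1) = d k + 1"
    "1 \<le> d (k-1) \<and> d (k-1) + 1 < L \<longrightarrow> d k = d (k-1) + 1"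
    "\<not> (d (k-1) = 0 \<and> d k = 0 \<and> d (k+1) = 0)"
    using good_gaps_at[OF assms(1,2)] by metis
  have l: "d (k-1) = 0 \<or> d (k-1) = L - 1" using h assms(3) by auto
  have r: "d (k+1) = 0 \<or> d (k+1) = 1" using h assms(3) by auto
  show ?thesis
  proof (cases "t = 0")
    case True
    then show ?thesis using h l r assms(2,3) unfolding stage_def by (elim disjE) simp_all
  next
    case False
    then have "stage L d t k = Wall False" using assms(3) unfolding stage_def by simp
    moreover have "fast_l (stage L d t (k+1)) \<longleftrightarrow> d (k+1) = 1 \<and> L - 1 = t"
      using r False unfolding stage_def by auto
    ultimately show ?thesis using l r h False assms(2,3) by (auto simp: signals_stage)
  qed
qed

text \<open>One formula serves both moving and meeting. When \<open>L = t + 1\<close> the slow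
  signals meet: in a single cell for odd \<open>t\<close>, and crossing between two cells for even
  \<open>t\<close>. Doubled positions avoid \<open>div\<close>.\<close>

lemma stage_step_inner:
  assumes "good_gaps L d" "2 \<le> L" "d k \<noteq> 0"
  defines "x \<equiv> d k"
  shows "ring_rule (stage L d t (k-1)) (stage L d t k) (stage L d t (k+1)) =
    (if odd t \<and> 2 * x = t + 1 \<and> L = t + 1 \<or> even t \<and> L = t + 1 \<and> (2 * x = t \<or> 2 * x = t + 2)
     then Wall True
     else Sig (x = t + 1) (L - x = t + 1)
       (if odd t \<and> 2 * x = t + 1 then Some True
        else if even t \<and> 2 * x = t + 2 then Some False else None)
       (if odd t \<and> 2 * (L - x) = t + 1 then Some True
        else if even t \<and> 2 * (L - x) = t + 2 then Some False else None))"
proof -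
  obtain h: "d k < L" "d (k+1) = 0 \<or> d (k+1) = d k + 1" "d k = 0 \<or> d k = d (k-1) + 1"
    "1 \<le> d k \<and> d k + 1 < L \<longrightarrow> d (k+1) = d k + 1" "d (k+1) < L"
    using good_gaps_at[OF assms(1,2)] by metis
  have e: "x = d (k-1) + 1" using h assms(3) unfolding x_def by simp
  have n: "d (k+1) = (if x + 1 < L then x + 1 else 0)" using h assms(3) unfolding x_def by auto
  have xL: "x < L" using h x_def by simp
  define y where "y = L - x"
  have y: "y > 0" "L = x + y" "x > 0" using xL e unfolding y_def by simp_all
  note sr = signals_stage[of L d t "k-1"] and sl = signals_stage_l[of x L d "k+1" t, OF xL n]
  have c: "stage L d t k = Sig (x = t) (y = t)
       (if x = (t+1) div 2 then Some (even t) else None)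
       (if y = (t+1) div 2 then Some (even t) else None)"
    using assms(3) unfolding stage_def x_def y_def by simp
  have d1: "d (k-1) = t \<longleftrightarrow> x = t + 1" "d (k-1) = u \<longleftrightarrow> x = u + 1" for u using e by auto
  show ?thesis
  proof (cases "even t")
    case True
    then obtain u where u: "t = 2*u" by (elim evenE)
    have a: "(t+1) div 2 = u" "t div 2 = u" using u by auto
    show ?thesis unfolding c ring_rule.simps sr sl d1 slow_next_def a y_def[symmetric]
      using True y u by auto
  next
    case False
    then obtain u where u: "t = 2*u+1" by (elim oddE)
    have a: "(t+1) div 2 = u+1" "t div 2 = u" using u by auto
    show ?thesis unfolding c ring_rule.simps sr sl d1 slow_next_def a y_def[symmetric]
      using False y u by auto
  qed
qed

lemma stage_step:
  assumes "good_gaps L d" "t + 1 < L"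
  shows "ring_rule (stage L d t (k-1)) (stage L d t k) (stage L d t (k+1)) = stage L d (t+1) k"
proof (cases "d k = 0")
  case True
  then show ?thesis using stage_step_wall[OF assms(1) _ True, of t] assms(2) unfolding stage_def by simp
next
  case False
  have L: "2 \<le> L" using assms(2) by simp
  have "odd t \<and> 2 * x = t + 1 \<longleftrightarrow> odd t \<and> x = (t+1+1) div 2"
    "even t \<and> 2 * x = t + 2 \<longleftrightarrow> even t \<and> x = (t+1+1) div 2" for x :: nat
    by presburger+
  then show ?thesis using stage_step_inner[OF assms(1) L, of k t] assms(2) False
    unfolding stage_def by simp
qed

lemma stage_restart:
  assumes "good_gaps L d" "2 \<le> L" "t + 1 = L"
  shows "ring_rule (stage L d t (k-1)) (stage L d t k) (stage L d t (k+1))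
     = stage (L div 2) (\<lambda>k. halve L (d k)) 0 k"
proof -
  have lt: "d k < L" using assms(1) unfolding good_gaps_def by blast
  have m: "halve L (d k) < L div 2"
    using good_gaps_halve[OF assms(1,2)] unfolding good_gaps_def by blast
  show ?thesis
  proof (cases "d k = 0")
    case True
    then show ?thesis using stage_step_wall[OF assms(1,2) True, of t] assms(2,3)
      unfolding stage_def halve_def by simp
  next
    case False
    define x where "x = d k"
    \<comment> \<open>The new zeros are exactly the cells that \<open>stage_step_inner\<close> turns
      into walls when \<open>L = t + 1\<close>.\<close>
    have z: "halve L x = 0 \<longleftrightarrow> odd t \<and> 2 * x = t + 1 \<or> even t \<and> (2 * x = t \<or> 2 * x = t + 2)"
      using False lt assms(3) unfolding x_def[symmetric] halve_def
      by (cases "even t") (auto elim!: evenE oddE)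
    note in_step = stage_step_inner[OF assms(1,2) False, of t, folded x_def]
    show ?thesis
    proof (cases "halve L x = 0")
      case True
      then show ?thesis unfolding in_step using z assms(3) by (simp add: stage_def x_def)
    next
      case nz: False
      \<comment> \<open>At the restart slow signals exist only at the meeting point, and fast ones
        have just been absorbed by the walls; every other inner cell becomes blank.\<close>
      have "\<not> (odd t \<and> 2 * (L - x) = t + 1)" "\<not> (even t \<and> 2 * (L - x) = t + 2)"
        using nz lt assms(3) unfolding z x_def[symmetric] by (auto elim!: evenE oddE)
      moreover have "x \<noteq> t + 1" "L - x \<noteq> t + 1" using lt False assms(3) unfolding x_def by simp_all
      moreover have "stage (L div 2) (\<lambda>k. halve L (d k)) 0 k = blank"
        using nz m unfolding stage_def x_def by simp
      ultimately show ?thesis unfolding in_step using nz z by auto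
    qed
  qed
qed

text \<open>Strong induction on the gap length: \<open>L\<close> steps lead to a fresh start with
  gaps \<open>L div 2\<close>. At \<open>L = 1\<close> every cell is a fresh wall between fresh
  walls, so all fire in the next step.\<close>

lemma ring_fires_from:
  assumes step: "\<And>t k. X (Suc t) k = ring_rule (X t (k-1)) (X t k) (X t (k+1))"
    and "good_gaps L d" and "\<And>k. X t0 k = stage L d 0 k"
  shows "\<exists>T>t0. (\<forall>k. X T k = Fire) \<and> (\<forall>t k. t0 \<le> t \<and> t < T \<longrightarrow> X t k \<noteq> Fire)"
  using assms(2,3)
proof (induction L arbitrary: d t0 rule: less_induct)
  case (less L)
  show ?case
  proof (cases "2 \<le> L")
    case True
    have st: "t < L \<Longrightarrow> X (t0 + t) k = stage L d t k" for t k
    proof (induction t arbitrary: k)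
      case 0 then show ?case using less.prems(2) by simp
    next
      case (Suc t)
      then show ?case using stage_step[OF less.prems(1), of t k] step[of "t0+t" k] by simp
    qed
    have "X (t0 + L) k = stage (L div 2) (\<lambda>k. halve L (d k)) 0 k" for k
    proof -
      obtain t where t: "L = Suc t" using True by (cases L) auto
      show ?thesis using stage_restart[OF less.prems(1) True, of t k] step[of "t0+t" k] st t by simp
    qed
    from less.IH[OF _ good_gaps_halve[OF less.prems(1) True] this] True
    obtain T where T: "T > t0 + L" "\<forall>k. X T k = Fire"
      "\<forall>t k. t0 + L \<le> t \<and> t < T \<longrightarrow> X t k \<noteq> Fire" by auto
    have "X t k \<noteq> Fire" if "t0 \<le> t" "t < T" for t k
    proof (cases "t < t0 + L")
      case True
      then have "X t k = stage L d (t - t0) k" using st[of "t - t0" k] that by simp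
      then show ?thesis unfolding stage_def by simp
    qed (use T that in auto)
    then show ?thesis using T by (intro exI[of _ T]) auto
  next
    case False
    have "d k = 0" for k
      using less.prems(1) False unfolding good_gaps_def by (metis less_2_cases less_one linorder_not_le order_less_le_trans not_less_zero One_nat_def Suc_1 less_Suc0 not_less_eq_eq)
    then have w: "X t0 k = Wall True" for k using less.prems(2) unfolding stage_def by simp
    have "X (Suc t0) k = Fire" for k using step[of t0 k] w by simp
    moreover have "t0 \<le> t \<Longrightarrow> t < Suc t0 \<Longrightarrow> X t k \<noteq> Fire" for t k
      using w by (metis le_antisym less_Suc_eq_le vstate.distinct(3))
    ultimately show ?thesis by (intro exI[of _ "Suc t0"]) blast
  qed
qed

text \<open>A ring of length \<open>N\<close> with one wall, unrolled to the integers: the wall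
  recurs with period \<open>N\<close>, so initially all gaps have length \<open>N\<close>.\<close>

lemma ring_fires:
  assumes "N \<ge> 2"
    and "\<And>t k. X (Suc t) k = ring_rule (X t (k-1)) (X t k) (X t (k+1))"
    and "\<And>k. X 0 k = (if k mod int N = k0 mod int N then Wall True else blank)"
  shows "\<exists>T. (\<forall>k. X T k = Fire) \<and> (\<forall>t<T. \<forall>k. X t k \<noteq> Fire)"
proof -
  define d where "d k = nat ((k - k0) mod int N)" for k
  have dN: "int (d k) = (k - k0) mod int N" for k using assms(1) unfolding d_def by simp
  have lt: "d k < N" for k
  proof -
    have "int (d k) < int N" unfolding dN using assms(1) by simp
    then show ?thesis by simp
  qed
  have s: "d (k+1) = (if d k + 1 = N then 0 else d k + 1)" for k
  proof -
    have "int (d (k+1)) = ((k - k0) + 1) mod int N" unfolding dN by (simp add: algebra_simps)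
    also have "\<dots> = ((k - k0) mod int N + 1) mod int N" by (simp add: mod_add_left_eq)
    also have "\<dots> = (int (d k) + 1) mod int N" unfolding dN by simp
    also have "\<dots> = int ((d k + 1) mod N)" by (simp add: zmod_int algebra_simps)
    finally have "d (k+1) = (d k + 1) mod N" by simp
    then show ?thesis using lt[of k] by auto
  qed
  have "good_gaps N d" unfolding good_gaps_def using lt s assms(1)
    by (auto simp del: One_nat_def) 
  moreover have "X 0 k = stage N d 0 k" for k
  proof -
    have "k mod int N = k0 mod int N \<longleftrightarrow> d k = 0"
      by (simp add: mod_eq_dvd_iff dvd_eq_mod_eq_0 dN[of k, symmetric])
    then show ?thesis unfolding stage_def assms(3) using lt[of k] by auto
  qed
  ultimately show ?thesis using ring_fires_from[of X N d 0] assms(2) by auto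
qed

section \<open>Configurations\<close>

definition opp :: "nat \<Rightarrow> nat" where "opp i = (i + 2) mod 4"

lemma opp_less [simp]: "opp i < 4" unfolding opp_def by simp

lemma less_4_cases: "(i::nat) < 4 \<longleftrightarrow> i = 0 \<or> i = 1 \<or> i = 2 \<or> i = 3" by auto

lemma opp_opp: "i < 4 \<Longrightarrow> opp (opp i) = i" unfolding opp_def by presburger

lemma padd_eps_inj: "i < 4 \<Longrightarrow> j < 4 \<Longrightarrow> padd x (eps i) = padd x (eps j) \<longleftrightarrow> i = j"
  unfolding padd_def eps_def by auto

lemma padd_opp: "i < 4 \<Longrightarrow> y = padd x (eps i) \<longleftrightarrow> x = padd y (eps (opp i))"
  unfolding less_4_cases padd_def eps_def opp_def by (cases x; cases y) auto

lemma adjacent_sym: "adjacent x y \<longleftrightarrow> adjacent y x"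
  unfolding adjacent_def using padd_opp opp_less by blast

lemma adjacent_irrefl: "\<not> adjacent x x"
  unfolding adjacent_def padd_def eps_def by (cases x) auto

lemma padd_eps_adjacent: "i < 4 \<Longrightarrow> adjacent x (padd x (eps i))"
  unfolding adjacent_def by blast

lemma config_adjacent_iff:
  assumes "is_config D" "l \<in> {lo D..hi D}" "m \<in> {lo D..hi D}"
  shows "adjacent (pos D l) (pos D m) \<longleftrightarrow> \<bar>l - m\<bar> = 1"
proof
  assume a: "adjacent (pos D l) (pos D m)"
  then have "\<not> \<bar>l - m\<bar> \<ge> 2" using assms unfolding is_config_def by blast
  moreover have "l \<noteq> m" using a adjacent_irrefl by metis
  ultimately show "\<bar>l - m\<bar> = 1" by auto
next
  assume "\<bar>l - m\<bar> = 1"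
  then consider "m = l + 1" | "l = m + 1" by linarith
  then show "adjacent (pos D l) (pos D m)"
  proof cases
    case 1 then show ?thesis using assms unfolding is_config_def by auto
  next
    case 2 then have "adjacent (pos D m) (pos D l)" using assms unfolding is_config_def by auto
    then show ?thesis using adjacent_sym by blast
  qed
qed

lemma config_inj:
  assumes "is_config D" "l \<in> {lo D..hi D}" "m \<in> {lo D..hi D}" "pos D l = pos D m"
  shows "l = m"
  using assms unfolding is_config_def inj_on_def by blast

lemma config_zero: "is_config D \<Longrightarrow> lo D \<le> 0 \<and> 0 \<le> hi D \<and> pos D 0 = (0,0)"
  unfolding is_config_def by blast

lemma pos_in_cells: "l \<in> {lo D..hi D} \<Longrightarrow> pos D l \<in> cells D"
  unfolding cells_def by blast

lemma adjacent_cell: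
  assumes "is_config D" "l \<in> {lo D..hi D}" "y \<in> cells D" "adjacent (pos D l) y"
  obtains "l + 1 \<le> hi D" "y = pos D (l+1)" | "lo D \<le> l - 1" "y = pos D (l-1)"
proof -
  obtain m where m: "m \<in> {lo D..hi D}" "y = pos D m" using assms(3) unfolding cells_def by blast
  then have "\<bar>l - m\<bar> = 1" using assms config_adjacent_iff by blast
  then consider "m = l + 1" | "m = l - 1" by linarith
  then show thesis using m that by cases auto
qed

lemma bc_eq_iff:
  "bc P x = bc P' x \<longleftrightarrow> (\<forall>y. adjacent x y \<longrightarrow> (y \<in> P \<longleftrightarrow> y \<in> P'))"
proof
  assume "bc P x = bc P' x"
  then show "\<forall>y. adjacent x y \<longrightarrow> (y \<in> P \<longleftrightarrow> y \<in> P')"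
    unfolding adjacent_def bc_def less_4_cases by (metis Pair_inject)
next
  assume a: "\<forall>y. adjacent x y \<longrightarrow> (y \<in> P \<longleftrightarrow> y \<in> P')"
  show "bc P x = bc P' x" unfolding bc_def using a padd_eps_adjacent[of _ x] by (simp del: split_paired_All)
qed

lemma is_config_cong:
  assumes "is_config D" "lo D' = lo D" "hi D' = hi D" "\<And>l. lo D \<le> l \<Longrightarrow> l \<le> hi D \<Longrightarrow> pos D' l = pos D l"
  shows "is_config D'" "cells D' = cells D"
proof -
  have "inj_on (pos D') {lo D..hi D}"
    using assms inj_on_cong[of "{lo D..hi D}" "pos D'" "pos D"] unfolding is_config_def by simp
  then show "is_config D'" using assms unfolding is_config_def by auto
  show "cells D' = cells D" unfolding cells_def assms(2,3) using assms(4) by (intro image_cong) auto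
qed

text \<open>The same cells traversed backwards. Runs depend only on the set of cells, so no
  automaton can tell the two indexings apart.\<close>

definition reverse :: "config \<Rightarrow> config" where
  "reverse D = \<lparr>lo = - hi D, hi = - lo D, pos = (\<lambda>l. pos D (- l))\<rparr>"

lemma cells_reverse: "cells (reverse D) = cells D"
proof -
  have "cells (reverse D) = pos D ` uminus ` {- hi D..- lo D}"
    unfolding cells_def reverse_def image_image by simp
  then show ?thesis unfolding cells_def by simp
qed

lemma is_config_reverse:
  assumes "is_config D" shows "is_config (reverse D)"
proof -
  have "inj_on (pos (reverse D)) {- hi D..- lo D}"
  proof (rule inj_onI)
    fix l m assume "l \<in> {- hi D..- lo D}" "m \<in> {- hi D..- lo D}" "pos (reverse D) l = pos (reverse D) m"
    then have "- l = - m" using assms by (intro config_inj[OF assms]) (auto simp: reverse_def)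
    then show "l = m" by simp
  qed
  moreover have "adjacent (pos D (- l)) (pos D (- (l+1)))" if "- hi D \<le> l" "l < - lo D" for l
    using that by (subst config_adjacent_iff[OF assms]) auto
  moreover have "\<not> adjacent (pos D (-l)) (pos D (-m))"
    if "l \<in> {- hi D..- lo D}" "m \<in> {- hi D..- lo D}" "\<bar>l - m\<bar> \<ge> 2" for l m
    using that by (subst config_adjacent_iff[OF assms]) auto
  ultimately show ?thesis using config_zero[OF assms] unfolding is_config_def by (simp add: reverse_def)
qed

section \<open>Automata over arbitrary finite state sets\<close>

type_synonym 'a local_rule = "'a \<Rightarrow> (nat \<Rightarrow> 'a option) \<Rightarrow> 'a"

definition neighbours :: "position set \<Rightarrow> (position \<Rightarrow> 'a) \<Rightarrow> position \<Rightarrow> nat \<Rightarrow> 'a option" where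
  "neighbours P st x i = (if i < 4 \<and> padd x (eps i) \<in> P then Some (st (padd x (eps i))) else None)"

fun evolve :: "'a local_rule \<Rightarrow> 'a \<Rightarrow> (bcode \<Rightarrow> 'a) \<Rightarrow> position set \<Rightarrow> nat \<Rightarrow> position \<Rightarrow> 'a" where
  "evolve R q G P 0 x = (if x = (0,0) then G (bc P (0,0)) else q)"
| "evolve R q G P (Suc t) x = R (evolve R q G P t x) (neighbours P (evolve R q G P t) x)"

definition four :: "'b option \<Rightarrow> 'b option \<Rightarrow> 'b option \<Rightarrow> 'b option \<Rightarrow> nat \<Rightarrow> 'b option" where
  "four a b c d i = (if i = 0 then a else if i = 1 then b else if i = 2 then c else if i = 3 then d else None)"

lemma four_Some: "four a b c d i = Some y \<Longrightarrow> Some y \<in> {a, b, c, d}"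
  unfolding four_def by (simp split: if_splits)

lemma four_None: "i \<ge> 4 \<Longrightarrow> four a b c d i = None"
  unfolding four_def by simp

lemma finite_bcode: "finite (UNIV :: bcode set)"
  by simp

text \<open>Rules over any finite state set are transported to natural numbers by an injection.
  Closure and quiescence need checking only for neighbour functions that are \<open>None\<close>
  from index 4 on.\<close>

lemma realize_automaton:
  fixes R :: "'a local_rule"
  assumes fin: "finite S" and q: "q \<in> S" and G: "\<And>b. G b \<in> S"
    and F: "F \<subseteq> S" "q \<notin> F"
    and closed: "\<And>s nb. s \<in> S \<Longrightarrow> (\<And>i y. nb i = Some y \<Longrightarrow> y \<in> S) \<Longrightarrow> (\<And>i. i \<ge> 4 \<Longrightarrow> nb i = None) \<Longrightarrow> R s nb \<in> S"
    and quiet: "\<And>nb. (\<And>i y. nb i = Some y \<Longrightarrow> y = q) \<Longrightarrow> (\<And>i. i \<ge> 4 \<Longrightarrow> nb i = None) \<Longrightarrow> R q nb = q"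
  shows "\<exists>A. is_automaton A \<and>
    (\<forall>P t x. run A P t x \<in> firing A \<longleftrightarrow> evolve R q G P t x \<in> F)"
proof -
  obtain e :: "'a \<Rightarrow> nat" where e: "inj_on e S"
    using finite_imp_inj_to_nat_seg[OF fin] by blast
  define dec where "dec = inv_into S e"
  have dec: "s \<in> S \<Longrightarrow> dec (e s) = s" for s unfolding dec_def using e by simp
  \<comment> \<open>Each boundary code gets a general state of its own, so \<open>tau\<close> is
    just a numbering of the codes.\<close>
  obtain eb :: "bcode \<Rightarrow> nat" and nb where eb: "inj eb" "eb ` UNIV = {i. i < nb}"
    using finite_imp_inj_to_nat_seg[OF finite_bcode] by blast
  have lt: "eb b < nb" for b using eb(2) by blast
  define A where "A = \<lparr> states = e ` S, quiescent = e q, ngen = nb,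
    gen = (\<lambda>k. e (G (inv eb k))), firing = e ` F, tau = eb,
    delta = (\<lambda>s a b c d. e (R (dec s) (four (map_option dec a) (map_option dec b)
        (map_option dec c) (map_option dec d)))) \<rparr>"
  have evS: "evolve R q G P t x \<in> S" for P t x
  proof (induction t arbitrary: x)
    case 0 then show ?case using q G by simp
  next
    case (Suc t)
    show ?case unfolding evolve.simps
    proof (rule closed)
      show "evolve R q G P t x \<in> S" by (rule Suc)
    qed (use Suc in \<open>simp_all add: neighbours_def split: if_splits del: split_paired_All\<close>, blast)
  qed
  have rn: "run A P t x = e (evolve R q G P t x)" for P t x
  proof (induction t arbitrary: x)
    case 0 then show ?case using eb(1) by (simp add: A_def)
  next
    case (Suc t)
    have "four (map_option dec (nbr P (run A P t) x 0)) (map_option dec (nbr P (run A P t) x 1))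
      (map_option dec (nbr P (run A P t) x 2)) (map_option dec (nbr P (run A P t) x 3))
      = neighbours P (evolve R q G P t) x"
      using Suc dec evS
      by (intro ext) (simp add: four_def nbr_def neighbours_def less_4_cases)
    then show ?case using Suc dec evS by (simp add: A_def)
  qed
  have opt: "a \<in> insert None (Some ` e ` S) \<Longrightarrow> map_option dec a = Some y \<Longrightarrow> y \<in> S" for a y
    using dec by auto
  have optq: "a \<in> {None, Some (e q)} \<Longrightarrow> map_option dec a = Some y \<Longrightarrow> y = q" for a y
    using dec[OF q] by auto
  have "is_automaton A"
    unfolding is_automaton_def
  proof (intro conjI ballI allI impI)
    fix x a b c d assume x: "x \<in> states A"
      and ab: "a \<in> insert None (Some ` states A)" "b \<in> insert None (Some ` states A)"
        "c \<in> insert None (Some ` states A)" "d \<in> insert None (Some ` states A)"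
    have "states A = e ` S" by (simp add: A_def)
    note ab' = ab[unfolded this]
    have "R (dec x) (four (map_option dec a) (map_option dec b) (map_option dec c) (map_option dec d)) \<in> S"
    proof (rule closed)
      show "dec x \<in> S" using x dec by (auto simp: A_def)
    next
      fix i y assume "four (map_option dec a) (map_option dec b) (map_option dec c) (map_option dec d) i = Some y"
      from four_Some[OF this] show "y \<in> S"
        using ab' opt by (metis empty_iff insert_iff)
    qed (rule four_None)
    then show "delta A x a b c d \<in> states A" by (simp add: A_def)
  next
    fix a b c d
    assume ab: "a \<in> {None, Some (quiescent A)}" "b \<in> {None, Some (quiescent A)}"
        "c \<in> {None, Some (quiescent A)}" "d \<in> {None, Some (quiescent A)}"
    have "quiescent A = e q" by (simp add: A_def)
    note ab' = ab[unfolded this]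
    have "R q (four (map_option dec a) (map_option dec b) (map_option dec c) (map_option dec d)) = q"
      
    proof (intro quiet)
      fix i y assume "four (map_option dec a) (map_option dec b) (map_option dec c) (map_option dec d) i = Some y"
      from four_Some[OF this] show "y = q"
        using ab' optq by (metis empty_iff insert_iff)
    qed (rule four_None)
    then show "delta A (quiescent A) a b c d = quiescent A" using dec[OF q] by (simp add: A_def)
  next
    show "quiescent A \<notin> firing A" using F e q by (auto simp: A_def inj_on_def)
  qed (use fin q G F lt in \<open>auto simp: A_def\<close>)
  moreover have "run A P t x \<in> firing A \<longleftrightarrow> evolve R q G P t x \<in> F" for P t x
    unfolding rn using evS[of P t x] F(1) inj_on_image_mem_iff[OF e] by (simp add: A_def)
  ultimately show ?thesis by blast
qed

section \<open>A firing squad solution for paths\<close>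

instance vstate :: finite
proof
  have "x \<in> range Wall \<union> (\<lambda>(a, b, c, d). Sig a b c d) ` UNIV \<union> {Fire}" for x
    by (cases x) (auto simp: image_def)
  then have "UNIV \<subseteq> range Wall \<union> (\<lambda>(a, b, c, d). Sig a b c d) ` UNIV \<union> {Fire}" by blast
  then show "finite (UNIV :: vstate set)" by (rule finite_subset) simp
qed

definition dirs_at :: "position set \<Rightarrow> position \<Rightarrow> nat set" where
  "dirs_at P x = {i. i < 4 \<and> padd x (eps i) \<in> P}"

definition dirs_bc :: "bcode \<Rightarrow> nat set" where
  "dirs_bc = (\<lambda>(a, b, c, d). {i. i = 0 \<and> a \<or> i = 1 \<and> b \<or> i = 2 \<and> c \<or> i = 3 \<and> d})"

lemma dirs_bc: "dirs_bc (bc P x) = dirs_at P x"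
  unfolding dirs_bc_def bc_def dirs_at_def less_4_cases by auto

definition dirs_nb :: "(nat \<Rightarrow> 'a option) \<Rightarrow> nat set" where
  "dirs_nb nb = {i. nb i \<noteq> None}"

lemma dirs_nb: "dirs_nb (neighbours P st x) = dirs_at P x"
  unfolding dirs_nb_def neighbours_def dirs_at_def by auto

text \<open>An awake node stores the set of directions in which it has neighbours and, for each such
  direction \<open>d\<close>, the state of the virtual cell given by its outgoing edge in direction \<open>d\<close>.
  A neighbour needs the direction set to tell which edge follows the one leading to this node.\<close>
type_synonym cell = "(nat set \<times> (nat \<Rightarrow> vstate)) option"

definition cval :: "cell \<Rightarrow> nat \<Rightarrow> vstate" where
  "cval c = (case c of None \<Rightarrow> (\<lambda>_. blank) | Some (N, s) \<Rightarrow> s)"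

lemma cval_simps [simp]: "cval None d = blank" "cval (Some (N, s)) d = s d"
  unfolding cval_def by simp_all

text \<open>Continuation of the tour through a node: the second direction if there is one, otherwise
  \<open>d\<close> itself, which makes the tour turn round at an end of the path.\<close>

definition other :: "nat set \<Rightarrow> nat \<Rightarrow> nat" where
  "other N d = (if \<exists>e\<in>N. e \<noteq> d then SOME e. e \<in> N \<and> e \<noteq> d else d)"

lemma other_pair: "other {d, e} d = e"
proof (cases "e = d")
  case False
  then have "(SOME e'. e' \<in> {d, e} \<and> e' \<noteq> d) = e" by (intro some_equality) auto
  then show ?thesis using False unfolding other_def by auto
qed (simp add: other_def)

lemma other_mem:
  assumes "d \<in> N" shows "other N d \<in> N"
proof (cases "\<exists>e\<in>N. e \<noteq> d")
  case True
  then have "\<exists>e. e \<in> N \<and> e \<noteq> d" by blast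
  from someI_ex[OF this] show ?thesis using True unfolding other_def by simp
qed (simp add: other_def assms)

text \<open>The preceding edge starts at the neighbour in direction \<open>e\<close> and points back
  to this node, so that neighbour stores it under \<open>opp e\<close>.\<close>

definition prev_val :: "(nat \<Rightarrow> cell option) \<Rightarrow> nat \<Rightarrow> vstate" where
  "prev_val nb d = (let e = other (dirs_nb nb) d in cval (the (nb e)) (opp e))"

definition next_val :: "(nat \<Rightarrow> cell option) \<Rightarrow> nat \<Rightarrow> vstate" where
  "next_val nb d = (case the (nb d) of None \<Rightarrow> blank | Some (N, s) \<Rightarrow> s (other N (opp d)))"

definition new_val :: "cell \<Rightarrow> (nat \<Rightarrow> cell option) \<Rightarrow> nat \<Rightarrow> vstate" where
  "new_val c nb d = (if d \<in> dirs_nb nb then ring_rule (prev_val nb d) (cval c d) (next_val nb d) else blank)"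

text \<open>A sleeping node counts as blank and awakes only when a signal enters it; this keeps
  \<open>None\<close> quiescent.\<close>

definition path_rule :: "cell local_rule" where
  "path_rule c nb = (if c = None \<and> new_val c nb = (\<lambda>_. blank) then None else Some (dirs_nb nb, new_val c nb))"

text \<open>A general without neighbours fires at once. Otherwise the single wall is put on one
  outgoing edge; \<open>Min\<close> is a choice that depends on the boundary code alone.\<close>

definition path_init :: "bcode \<Rightarrow> cell" where
  "path_init b = (if dirs_bc b = {} then Some ({}, \<lambda>i. if i < 4 then Fire else blank)
     else Some (dirs_bc b, \<lambda>d. if d = Min (dirs_bc b) then Wall True else blank))"

definition path_states :: "cell set" where
  "path_states = insert None (Some ` (Pow {..<4} \<times> {s. \<forall>i. i \<notin> {..<4} \<longrightarrow> s i = blank}))"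

definition path_firing :: "cell set" where
  "path_firing = {c \<in> path_states. \<exists>d. cval c d = Fire}"

lemma finite_path_states: "finite path_states"
proof -
  have "finite {s :: nat \<Rightarrow> vstate. \<forall>i. (i \<in> {..<4} \<longrightarrow> s i \<in> UNIV) \<and> (i \<notin> {..<4} \<longrightarrow> s i = blank)}"
    by (intro finite_set_of_finite_funs) auto
  then show ?thesis unfolding path_states_def by (intro finite.insertI finite_imageI finite_cartesian_product) simp_all
qed

lemma path_rule_closed:
  assumes "\<And>i. i \<ge> 4 \<Longrightarrow> nb i = None"
  shows "path_rule c nb \<in> path_states"
proof -
  have N: "dirs_nb nb \<subseteq> {..<4}" using assms unfolding dirs_nb_def by (auto simp: not_le[symmetric])
  then have "i \<notin> {..<4} \<Longrightarrow> new_val c nb i = blank" for i unfolding new_val_def by auto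
  then have "(dirs_nb nb, new_val c nb) \<in> Pow {..<4} \<times> {s. \<forall>i. i \<notin> {..<4} \<longrightarrow> s i = blank}"
    using N by blast
  then show ?thesis unfolding path_rule_def path_states_def by simp
qed

lemma path_rule_quiet:
  assumes "\<And>i y. nb i = Some y \<Longrightarrow> y = None"
  shows "path_rule None nb = None"
proof -
  have a: "i \<in> dirs_nb nb \<Longrightarrow> the (nb i) = None" for i
    using assms unfolding dirs_nb_def by auto
  have "new_val None nb d = blank" for d
  proof (cases "d \<in> dirs_nb nb")
    case True
    then show ?thesis using a[OF True] a[OF other_mem[OF True]]
      by (simp add: new_val_def prev_val_def next_val_def slow_next_def)
  qed (simp add: new_val_def)
  then show ?thesis unfolding path_rule_def by auto
qed

lemma path_init_states: "path_init b \<in> path_states"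
proof -
  have "dirs_bc b \<subseteq> {..<4}" unfolding dirs_bc_def by (auto split: prod.splits)
  moreover from this have "dirs_bc b \<noteq> {} \<Longrightarrow> Min (dirs_bc b) < 4"
    by (meson Min_in finite_lessThan finite_subset lessThan_iff subsetD)
  ultimately show ?thesis unfolding path_init_def path_states_def by auto
qed

text \<open>Folding a cycle of length \<open>2 * n\<close> onto a path of \<open>n + 1\<close> nodes
  identifies \<open>a\<close> only with \<open>2 * n - a\<close>. The successors of two such
  distinct points move in opposite directions along the path, so both endpoints together determine
  the edge.\<close>

lemma fold_succ_inj:
  fixes a b n :: int
  assumes "0 \<le> a" "a < 2 * n" "0 \<le> b" "b < 2 * n"
    "min a (2 * n - a) = min b (2 * n - b)" "min a' (2 * n - a') = min b' (2 * n - b')"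
    "a' = (if a + 1 = 2 * n then 0 else a + 1)" "b' = (if b + 1 = 2 * n then 0 else b + 1)"
  shows "a = b"
proof (rule ccontr)
  assume ne: "a \<noteq> b"
  have s: "a + b = 2 * n" using assms(5) ne by (simp add: min_def split: if_splits)
  have a': "min a' (2 * n - a') = (if a < n then a + 1 else 2 * n - a - 1)" if "a \<noteq> n"
    using assms(1,2,7) that by (cases "a + 1 = 2 * n") (auto simp: min_def)
  have b': "min b' (2 * n - b') = (if b < n then b + 1 else 2 * n - b - 1)" if "b \<noteq> n"
    using assms(3,4,8) that by (cases "b + 1 = 2 * n") (auto simp: min_def)
  show False using a' b' s ne assms(6) by (auto split: if_splits)
qed

section \<open>The tour along the directed edges of a path\<close>

locale long_path =
  fixes D :: config
  assumes config: "is_config D" and long: "lo D < hi D"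
begin

definition period :: int where "period = 2 * (hi D - lo D)"

definition residue :: "int \<Rightarrow> int" where "residue k = k mod period"

text \<open>The ring of directed edges: edge \<open>k\<close> leads from node \<open>tour k\<close> to node \<open>tour (k+1)\<close>.\<close>
definition tour :: "int \<Rightarrow> int" where
  "tour k = lo D + min (residue k) (2 * (hi D - lo D) - residue k)"

lemma period_pos: "period > 0" unfolding period_def using long by simp

lemma residue: "0 \<le> residue k" "residue k < 2 * (hi D - lo D)"
  using period_pos pos_mod_bound[OF period_pos, of k] unfolding residue_def period_def by auto

lemma residue_succ: "residue (k+1) = (if residue k + 1 = 2 * (hi D - lo D) then 0 else residue k + 1)"
proof -
  have "residue (k+1) = (residue k + 1) mod period" unfolding residue_def by (simp add: mod_add_left_eq)
  then show ?thesis using residue[of k] unfolding period_def by auto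
qed

lemma residue_uminus: "residue (- k) = (if residue k = 0 then 0 else 2 * (hi D - lo D) - residue k)"
  unfolding residue_def zmod_zminus1_eq_if period_def by simp

lemma tour_range: "tour k \<in> {lo D..hi D}"
  using residue[of k] long unfolding tour_def by auto

lemma tour_uminus: "tour (- k) = tour k"
  unfolding tour_def residue_uminus using residue[of k] by auto

lemma tour_succ: "\<bar>tour (k+1) - tour k\<bar> = 1"
  using residue[of k] long residue_succ[of k] unfolding tour_def by (smt (verit) min_def)

lemma tour_onto:
  assumes "l \<in> {lo D..hi D}" shows "tour (l - lo D) = l"
proof -
  have "residue (l - lo D) = l - lo D"
    using assms long unfolding residue_def period_def by simp
  then show ?thesis using assms unfolding tour_def by simp
qed

lemma tour_neighbours:
  "tour k + 1 \<le> hi D \<Longrightarrow> tour k + 1 \<in> {tour (k+1), tour (k-1)}"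
  "lo D \<le> tour k - 1 \<Longrightarrow> tour k - 1 \<in> {tour (k+1), tour (k-1)}"
proof -
  have r: "residue k = (if residue (k-1) + 1 = 2 * (hi D - lo D) then 0 else residue (k-1) + 1)"
    using residue_succ[of "k-1"] by simp
  show "tour k + 1 \<le> hi D \<Longrightarrow> tour k + 1 \<in> {tour (k+1), tour (k-1)}"
    using residue[of k] residue[of "k-1"] r long residue_succ[of k] unfolding tour_def insert_iff by (smt (verit) min_def)
  show "lo D \<le> tour k - 1 \<Longrightarrow> tour k - 1 \<in> {tour (k+1), tour (k-1)}"
    using residue[of k] residue[of "k-1"] r long residue_succ[of k] unfolding tour_def insert_iff by (smt (verit) min_def)
qed

lemma tour_edge_inj:
  assumes "tour k = tour k'" "tour (k+1) = tour (k'+1)"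
  shows "residue k = residue k'"
  using assms unfolding tour_def
  by (intro fold_succ_inj[OF residue residue _ _ residue_succ residue_succ]) simp_all

lemma tour_cong: "residue k = residue k' \<Longrightarrow> tour k = tour k' \<and> tour (k+1) = tour (k'+1)"
  unfolding tour_def residue_succ by simp

definition dir :: "int \<Rightarrow> nat" where
  "dir k = (SOME i. i < 4 \<and> pos D (tour (k+1)) = padd (pos D (tour k)) (eps i))"

lemma dir: "dir k < 4" "pos D (tour (k+1)) = padd (pos D (tour k)) (eps (dir k))"
proof -
  have "adjacent (pos D (tour k)) (pos D (tour (k+1)))"
    using config_adjacent_iff[OF config tour_range tour_range, of k "k+1"] tour_succ[of k] by simp
  then have "\<exists>i. i < 4 \<and> pos D (tour (k+1)) = padd (pos D (tour k)) (eps i)" unfolding adjacent_def .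
  from someI_ex[OF this] show "dir k < 4" "pos D (tour (k+1)) = padd (pos D (tour k)) (eps (dir k))"
    unfolding dir_def by blast+
qed

lemma dir_eqI: "i < 4 \<Longrightarrow> pos D (tour (k+1)) = padd (pos D (tour k)) (eps i) \<Longrightarrow> dir k = i"
  using dir[of k] padd_eps_inj by metis

lemma dir_back: "pos D (tour k) = padd (pos D (tour (k+1))) (eps (opp (dir k)))"
  using padd_opp dir by blast

text \<open>Edge \<open>- k\<close> is edge \<open>k - 1\<close> reversed, so the edges leaving node
  \<open>tour k\<close> are \<open>k\<close> and \<open>- k\<close>.\<close>

lemma dir_uminus: "dir (- k) = opp (dir (k - 1))"
proof (rule dir_eqI)
  have "tour (- k + 1) = tour (k - 1)" using tour_uminus[of "k-1"] by simp
  then show "pos D (tour (- k + 1)) = padd (pos D (tour (- k))) (eps (opp (dir (k - 1))))"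
    using dir_back[of "k-1"] tour_uminus[of k] by simp
qed simp

lemma dirs_tour: "dirs_at (cells D) (pos D (tour k)) = {dir k, opp (dir (k - 1))}"
proof
  show "{dir k, opp (dir (k - 1))} \<subseteq> dirs_at (cells D) (pos D (tour k))"
    using dir[of k] dir_back[of "k-1"] pos_in_cells[OF tour_range] unfolding dirs_at_def
    by (metis (no_types, lifting) CollectI diff_add_cancel empty_subsetI insert_subset opp_less)
  show "dirs_at (cells D) (pos D (tour k)) \<subseteq> {dir k, opp (dir (k - 1))}"
  proof
    fix i assume "i \<in> dirs_at (cells D) (pos D (tour k))"
    then have i: "i < 4" "padd (pos D (tour k)) (eps i) \<in> cells D" unfolding dirs_at_def by auto
    have "padd (pos D (tour k)) (eps i) \<in> {pos D (tour (k+1)), pos D (tour (k-1))}"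
      using adjacent_cell[OF config tour_range i(2) padd_eps_adjacent[OF i(1)]] tour_neighbours[of k]
      by (smt (verit, best) empty_iff insert_iff)
    then show "i \<in> {dir k, opp (dir (k - 1))}"
      using dir_eqI[OF i(1), of k] dir_back[of "k-1"] padd_eps_inj[OF i(1)] opp_less by auto
  qed
qed

lemma edge_ex:
  assumes "l \<in> {lo D..hi D}" "d \<in> dirs_at (cells D) (pos D l)"
  shows "\<exists>k. tour k = l \<and> dir k = d"
proof -
  define k where "k = l - lo D"
  have k: "tour k = l" using tour_onto assms(1) unfolding k_def by blast
  then have "d = dir k \<or> d = dir (- k)" using assms(2) dirs_tour[of k] dir_uminus by auto
  then show ?thesis using k tour_uminus by metis
qed

fun ring :: "int \<Rightarrow> nat \<Rightarrow> int \<Rightarrow> vstate" where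
  "ring k0 0 k = (if residue k = residue k0 then Wall True else blank)"
| "ring k0 (Suc t) k = ring_rule (ring k0 t (k-1)) (ring k0 t k) (ring k0 t (k+1))"

abbreviation "st \<equiv> evolve path_rule None path_init (cells D)"

text \<open>\<open>next_val\<close> reads the direction set stored by a neighbour, so the simulation
  needs it to be the true one.\<close>

definition well_formed :: "cell \<Rightarrow> position \<Rightarrow> bool" where
  "well_formed c x \<longleftrightarrow> c = None \<or> (\<exists>s. c = Some (dirs_at (cells D) x, s) \<and>
     (\<forall>d. d \<notin> dirs_at (cells D) x \<longrightarrow> s d = blank))"

lemma well_formed: "x \<in> cells D \<Longrightarrow> well_formed (st t x) x"
proof (induction t)
  case 0
  have "dirs_at (cells D) (pos D 0) \<noteq> {}" using dirs_tour[of "0 - lo D"] tour_onto[of 0] config_zero[OF config]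
    by simp
  then have ne: "dirs_at (cells D) (0,0) \<noteq> {}" using config_zero[OF config] by simp
  have "finite (dirs_at (cells D) (0,0))" unfolding dirs_at_def by simp
  with ne have "Min (dirs_at (cells D) (0,0)) \<in> dirs_at (cells D) (0,0)" by simp
  then show ?case using ne by (auto simp: well_formed_def path_init_def dirs_bc)
next
  case (Suc t)
  show ?case by (auto simp: well_formed_def path_rule_def dirs_nb new_val_def)
qed

lemma simulate:
  assumes k0: "tour k0 = 0" "dir k0 = Min (dirs_at (cells D) (0,0))"
  shows "cval (st t (pos D (tour k))) (dir k) = ring k0 t k"
proof (induction t arbitrary: k)
  case 0
  have z: "pos D (tour k) = (0,0) \<longleftrightarrow> tour k = 0"
    using config_zero[OF config] config_inj[OF config tour_range, of 0 k] by auto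
  have ne: "dirs_at (cells D) (0,0) \<noteq> {}"
    using dirs_tour[of k0] k0 config_zero[OF config] by auto
  \<comment> \<open>The edge carrying the initial wall corresponds to exactly one residue, so the
    ring starts with a single wall.\<close>
  have "tour k = 0 \<and> dir k = dir k0 \<longleftrightarrow> residue k = residue k0"
  proof
    assume a: "tour k = 0 \<and> dir k = dir k0"
    then have "pos D (tour (k+1)) = pos D (tour (k0+1))" using dir(2)[of k] dir(2)[of k0] k0 by simp
    then have "tour (k+1) = tour (k0+1)" by (rule config_inj[OF config tour_range tour_range])
    then show "residue k = residue k0" using a k0 by (intro tour_edge_inj) simp_all
  next
    assume "residue k = residue k0"
    then have a: "tour k = tour k0" "tour (k+1) = tour (k0+1)" using tour_cong[of k k0] by blast+
    then have "dir k = dir k0" using dir[of k0] by (intro dir_eqI) simp_all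
    then show "tour k = 0 \<and> dir k = dir k0" using a k0 by simp
  qed
  then show ?case using z ne k0 by (auto simp: path_init_def dirs_bc)
next
  case (Suc t)
  define x where "x = pos D (tour k)"
  define nb where "nb = neighbours (cells D) (st t) x"
  have N: "dirs_nb nb = {dir k, opp (dir (k-1))}"
    unfolding nb_def dirs_nb x_def dirs_tour ..
  have nb: "i \<in> dirs_nb nb \<Longrightarrow> the (nb i) = st t (padd x (eps i))" for i
    unfolding nb_def dirs_nb dirs_at_def neighbours_def by simp
  have "padd x (eps (opp (dir (k-1)))) = pos D (tour (k-1))" unfolding x_def using dir_back[of "k-1"] by simp
  then have prev: "prev_val nb (dir k) = ring k0 t (k-1)"
    unfolding prev_val_def N other_pair Let_def using nb[of "opp (dir (k-1))"] N Suc[of "k-1"]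
      opp_opp[OF dir(1)] by simp
  have "padd x (eps (dir k)) = pos D (tour (k+1))" unfolding x_def using dir(2)[of k] by simp
  then have nk: "the (nb (dir k)) = st t (pos D (tour (k+1)))" using nb[of "dir k"] N by simp
  have "dirs_at (cells D) (pos D (tour (k+1))) = {opp (dir k), dir (k+1)}"
    unfolding dirs_tour by auto
  then have "next_val nb (dir k) = cval (st t (pos D (tour (k+1)))) (dir (k+1))"
    unfolding next_val_def nk using well_formed[OF pos_in_cells[OF tour_range], of t "k+1"]
    by (auto simp: well_formed_def other_pair)
  then have nxt: "next_val nb (dir k) = ring k0 t (k+1)" using Suc by simp
  have "new_val (st t x) nb (dir k) = ring k0 (Suc t) k"
    unfolding new_val_def prev nxt using N Suc[of k] by (simp add: x_def)
  \<comment> \<open>If the node stays asleep, the new values are all blank, which is what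
    \<open>cval None\<close> returns.\<close>
  moreover have "cval (path_rule (st t x) nb) d = new_val (st t x) nb d" for d
    unfolding path_rule_def by (auto dest: fun_cong)
  ultimately show ?case unfolding evolve.simps x_def[symmetric] nb_def[symmetric] by simp
qed

lemma fires:
  "\<exists>T. (\<forall>x\<in>cells D. \<exists>d. cval (st T x) d = Fire) \<and> (\<forall>t<T. \<forall>x\<in>cells D. \<forall>d. cval (st t x) d \<noteq> Fire)"
proof -
  have ne: "dirs_at (cells D) (pos D 0) \<noteq> {}" using dirs_tour[of "0 - lo D"] tour_onto[of 0] config_zero[OF config]
    by simp
  have "finite (dirs_at (cells D) (pos D 0))" unfolding dirs_at_def by simp
  with ne have "Min (dirs_at (cells D) (pos D 0)) \<in> dirs_at (cells D) (pos D 0)" by simp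
  then obtain k0 where k0: "tour k0 = 0" "dir k0 = Min (dirs_at (cells D) (0,0))"
    using edge_ex[of 0] config_zero[OF config] by auto
  note sim = simulate[OF k0]
  have "2 \<le> nat period" "int (nat period) = period" using long unfolding period_def by auto
  then obtain T where T: "\<forall>k. ring k0 T k = Fire" "\<forall>t<T. \<forall>k. ring k0 t k \<noteq> Fire"
    using ring_fires[of "nat period" "ring k0" k0] unfolding residue_def by (auto simp: residue_def)
  have "\<exists>d. cval (st T x) d = Fire" if x: "x \<in> cells D" for x
  proof -
    obtain l where "l \<in> {lo D..hi D}" "x = pos D l" using x unfolding cells_def by blast
    then show ?thesis using sim[of T "l - lo D"] tour_onto[of l] T(1) by metis
  qed
  moreover have "cval (st t x) d \<noteq> Fire" if t: "t < T" and x: "x \<in> cells D" for t x d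
  proof (cases "d \<in> dirs_at (cells D) x")
    case True
    obtain l where l: "l \<in> {lo D..hi D}" "x = pos D l" using x unfolding cells_def by blast
    then obtain k where "tour k = l" "dir k = d" using edge_ex True by blast
    then show ?thesis using sim[of t k] T(2) t l by simp
  next
    case False
    then show ?thesis using well_formed[OF x, of t] unfolding well_formed_def by auto
  qed
  ultimately show ?thesis by blast
qed

end

lemma solution_exists: "\<exists>A. is_solution A"
proof -
  have "\<exists>A. is_automaton A \<and> (\<forall>P t x. run A P t x \<in> firing A \<longleftrightarrow>
      evolve path_rule None path_init P t x \<in> path_firing)"
  proof (rule realize_automaton[OF finite_path_states])
    show "None \<in> path_states" unfolding path_states_def by simp
    show "path_firing \<subseteq> path_states" "None \<notin> path_firing" unfolding path_firing_def by auto
  qed (use path_init_states path_rule_closed path_rule_quiet in blast)+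
  then obtain A where A: "is_automaton A" "\<And>P t x. run A P t x \<in> firing A \<longleftrightarrow>
      evolve path_rule None path_init P t x \<in> path_firing" by blast
  have mem: "evolve path_rule None path_init P t x \<in> path_states" for P t x
  proof (cases t)
    case 0
    then show ?thesis using path_init_states by (simp add: path_states_def)
  next
    case (Suc t')
    show ?thesis unfolding Suc evolve.simps by (rule path_rule_closed) (simp add: neighbours_def)
  qed
  have fire_iff: "run A P t x \<in> firing A \<longleftrightarrow> (\<exists>d. cval (evolve path_rule None path_init P t x) d = Fire)" for P t x
    unfolding A(2) path_firing_def using mem by simp
  have "\<exists>t. fires_at A D t" if D: "is_config D" for D
  proof (cases "lo D < hi D")
    case True
    then interpret long_path D using D by unfold_locales
    show ?thesis using fires unfolding fires_at_def fire_iff by blast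
  next
    case False
    \<comment> \<open>Only the isolated general remains, which fires at time 0.\<close>
    then have "lo D = 0" "hi D = 0" using config_zero[OF D] by auto
    then have "cells D = {(0,0)}" using config_zero[OF D] unfolding cells_def by simp
    moreover have "dirs_at {(0,0)} (0,0) = {}" unfolding dirs_at_def padd_def eps_def by auto
    ultimately show ?thesis unfolding fires_at_def fire_iff
      by (intro exI[of _ 0]) (auto simp: path_init_def dirs_bc intro!: exI[of _ 0])
  qed
  then show ?thesis using A(1) unfolding is_solution_def by blast
qed

section \<open>Propagation of knowledge\<close>

text \<open>Confines the positions reached by time \<open>T\<close> to the finite set
  \<open>box T\<close>.\<close>

lemma pos_bound:
  assumes "is_config D" "l \<in> {lo D..hi D}"
  shows "\<bar>fst (pos D l)\<bar> \<le> \<bar>l\<bar> \<and> \<bar>snd (pos D l)\<bar> \<le> \<bar>l\<bar>"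
proof -
  have step: "\<bar>fst y\<bar> \<le> \<bar>fst x\<bar> + 1 \<and> \<bar>snd y\<bar> \<le> \<bar>snd x\<bar> + 1" if "adjacent x y" for x y
    using that unfolding adjacent_def padd_def eps_def by auto
  have "\<forall>l. l \<in> {lo D..hi D} \<and> \<bar>l\<bar> = int n \<longrightarrow> \<bar>fst (pos D l)\<bar> \<le> int n \<and> \<bar>snd (pos D l)\<bar> \<le> int n" for n
  proof (induction n)
    case 0 then show ?case using config_zero[OF assms(1)] by auto
  next
    case (Suc n)
    show ?case
    proof (intro allI impI)
      fix l assume l: "l \<in> {lo D..hi D} \<and> \<bar>l\<bar> = int (Suc n)"
      define k where "k = (if l > 0 then l - 1 else l + 1)"
      have k: "k \<in> {lo D..hi D}" "\<bar>k\<bar> = int n" "\<bar>k - l\<bar> = 1"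
        using l config_zero[OF assms(1)] unfolding k_def by auto
      then have "adjacent (pos D k) (pos D l)" using config_adjacent_iff[OF assms(1)] l by simp
      then show "\<bar>fst (pos D l)\<bar> \<le> int (Suc n) \<and> \<bar>snd (pos D l)\<bar> \<le> int (Suc n)"
        using step[of "pos D k" "pos D l"] Suc.IH k by fastforce
    qed
  qed
  from this[of "nat \<bar>l\<bar>"] show ?thesis using assms(2) by simp
qed

type_synonym fact = "position \<times> bcode"
text \<open>Own position, clock, known facts. A node learns its position from the neighbour that wakes it;
  after the clock has reached \<open>T\<close> everything is forgotten, which keeps the state set finite.\<close>
type_synonym knowledge = "(position \<times> nat \<times> fact set) option"

definition fact_at :: "config \<Rightarrow> int \<Rightarrow> fact" where
  "fact_at D l = (pos D l, bc (cells D) (pos D l))"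

definition facts :: "config \<Rightarrow> fact set" where
  "facts D = fact_at D ` {lo D..hi D}"

definition bc_nb :: "(nat \<Rightarrow> 'a option) \<Rightarrow> bcode" where
  "bc_nb nb = (nb 0 \<noteq> None, nb 1 \<noteq> None, nb 2 \<noteq> None, nb 3 \<noteq> None)"

lemma bc_nb: "bc_nb (neighbours P st x) = bc P x"
  unfolding bc_nb_def bc_def neighbours_def by simp

definition gather :: "(nat \<Rightarrow> knowledge option) \<Rightarrow> fact set" where
  "gather nb = \<Union>{K. \<exists>i x t. nb i = Some (Some (x, t, K))}"

definition informants :: "nat \<Rightarrow> (nat \<Rightarrow> knowledge option) \<Rightarrow> (nat \<times> position \<times> nat) set" where
  "informants T nb = {(i, x, t). i < 4 \<and> t < T \<and> (\<exists>K. nb i = Some (Some (x, t, K)))}"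

text \<open>The informant is chosen arbitrarily: on a configuration all informants yield the same
  position and clock.\<close>

definition wake :: "nat \<Rightarrow> (nat \<Rightarrow> knowledge option) \<Rightarrow> knowledge" where
  "wake T nb = (if informants T nb = {} then None else
     (case (SOME w. w \<in> informants T nb) of (i, x, t) \<Rightarrow>
       Some (padd x (eps (opp i)), Suc t, insert (padd x (eps (opp i)), bc_nb nb) (gather nb))))"

definition knowledge_step :: "nat \<Rightarrow> knowledge local_rule" where
  "knowledge_step T c nb = (case c of None \<Rightarrow> wake T nb
     | Some (x, t, K) \<Rightarrow> if t < T then Some (x, Suc t, K \<union> gather nb) else None)"

definition box :: "nat \<Rightarrow> position set" where
  "box T = {- int T..int T} \<times> {- int T..int T}"

definition knowledge_states :: "nat \<Rightarrow> knowledge set" where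
  "knowledge_states T = insert None (Some ` (box T \<times> {..T} \<times> Pow (box T \<times> UNIV)))"

text \<open>Clipping enforces closure of the finite state set even for inconsistent inputs. By
  \<open>informed_states\<close> it does not alter the knowledge of awake nodes of a configuration
  up to time \<open>T\<close>.\<close>

definition knowledge_rule :: "nat \<Rightarrow> knowledge local_rule" where
  "knowledge_rule T c nb = (if knowledge_step T c nb \<in> knowledge_states T then knowledge_step T c nb else None)"

definition knowledge_init :: "bcode \<Rightarrow> knowledge" where
  "knowledge_init b = Some ((0,0), 0, {((0,0), b)})"

lemma finite_knowledge_states: "finite (knowledge_states T)"
  unfolding knowledge_states_def box_def by simp

lemma knowledge_rule_closed: "knowledge_rule T c nb \<in> knowledge_states T"
  unfolding knowledge_rule_def knowledge_states_def by simp

lemma knowledge_init_states: "knowledge_init b \<in> knowledge_states T"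
  unfolding knowledge_init_def knowledge_states_def box_def by auto

lemma knowledge_rule_quiet:
  assumes "\<And>i y. nb i = Some y \<Longrightarrow> y = None"
  shows "knowledge_rule T None nb = None"
proof -
  have "informants T nb = {}" using assms unfolding informants_def by fastforce
  then show ?thesis unfolding knowledge_rule_def knowledge_step_def wake_def by simp
qed

abbreviation know :: "nat \<Rightarrow> config \<Rightarrow> nat \<Rightarrow> position \<Rightarrow> knowledge" where
  "know T D \<equiv> evolve (knowledge_rule T) None knowledge_init (cells D)"

text \<open>Soundness above, completeness below: the general's signal takes
  \<open>\<bar>m\<bar>\<close> steps to node \<open>m\<close>, whose fact then takes
  \<open>\<bar>m - l\<bar>\<close> steps to node \<open>l\<close>.\<close>

definition informed :: "config \<Rightarrow> int \<Rightarrow> nat \<Rightarrow> fact set \<Rightarrow> bool" where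
  "informed D l t K \<longleftrightarrow> K \<subseteq> fact_at D ` {m \<in> {lo D..hi D}. \<bar>m\<bar> \<le> int t} \<and>
     fact_at D ` {m \<in> {lo D..hi D}. \<bar>m\<bar> + \<bar>m - l\<bar> \<le> int t} \<subseteq> K"

definition sound_at :: "nat \<Rightarrow> config \<Rightarrow> nat \<Rightarrow> bool" where
  "sound_at T D t \<longleftrightarrow> (\<forall>l\<in>{lo D..hi D}.
     if \<bar>l\<bar> \<le> int t then \<exists>K. know T D t (pos D l) = Some (pos D l, t, K) \<and> informed D l t K
     else know T D t (pos D l) = None)"

lemma informed_states:
  assumes "is_config D" "l \<in> {lo D..hi D}" "\<bar>l\<bar> \<le> int t" "t \<le> T" "informed D l t K"
  shows "Some (pos D l, t, K) \<in> knowledge_states T"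
proof -
  have b: "pos D m \<in> box T" if "m \<in> {lo D..hi D}" "\<bar>m\<bar> \<le> int t" for m
    using pos_bound[OF assms(1) that(1)] that(2) assms(4) unfolding box_def
    by (cases "pos D m") auto
  then have "fact_at D ` {m \<in> {lo D..hi D}. \<bar>m\<bar> \<le> int t} \<subseteq> box T \<times> UNIV"
    unfolding fact_at_def by blast
  then have "K \<subseteq> box T \<times> UNIV" using assms(5) unfolding informed_def by blast
  then show ?thesis using assms(4) b[OF assms(2,3)] unfolding knowledge_states_def by simp
qed

lemma neighbours_SomeD:
  assumes "is_config D" "l \<in> {lo D..hi D}" "neighbours (cells D) st (pos D l) i = Some y"
  obtains m where "m \<in> {lo D..hi D}" "\<bar>m - l\<bar> = 1" "y = st (pos D m)" "i < 4"
    "padd (pos D l) (eps i) = pos D m"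
proof -
  have a: "i < 4" "padd (pos D l) (eps i) \<in> cells D" "y = st (padd (pos D l) (eps i))"
    using assms(3) unfolding neighbours_def by (auto split: if_splits)
  obtain m where m: "m \<in> {lo D..hi D}" "padd (pos D l) (eps i) = pos D m"
    using a(2) unfolding cells_def by blast
  have "\<bar>l - m\<bar> = 1"
    using padd_eps_adjacent[OF a(1), of "pos D l"] config_adjacent_iff[OF assms(1,2) m(1)] m(2) by simp
  then show thesis using that[of m] m a by simp
qed

lemma neighbours_ex:
  assumes "is_config D" "l \<in> {lo D..hi D}" "m \<in> {lo D..hi D}" "\<bar>m - l\<bar> = 1"
  obtains i where "i < 4" "neighbours (cells D) st (pos D l) i = Some (st (pos D m))"
proof -
  have "adjacent (pos D l) (pos D m)" using config_adjacent_iff[OF assms(1-3)] assms(4) by simp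
  then obtain i where "i < 4" "pos D m = padd (pos D l) (eps i)" unfolding adjacent_def by blast
  then show thesis using that[of i] pos_in_cells[OF assms(3)] unfolding neighbours_def by simp
qed

text \<open>A fact of \<open>m\<close> distinct from \<open>l\<close> that is due at
  \<open>l\<close> one step later is already known to the neighbour of \<open>l\<close> towards
  \<open>m\<close>. \<open>K0\<close> is the node's own contribution: its old knowledge, or its own
  fact on waking.\<close>

lemma informed_gather:
  assumes D: "is_config D" and l: "l \<in> {lo D..hi D}" and s: "sound_at T D t" and lt: "\<bar>l\<bar> \<le> int t + 1"
    and K0: "K0 \<subseteq> fact_at D ` {m \<in> {lo D..hi D}. \<bar>m\<bar> \<le> int t + 1}"
      "\<bar>l\<bar> = int t + 1 \<Longrightarrow> fact_at D l \<in> K0"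
      "fact_at D ` {m \<in> {lo D..hi D}. \<bar>m\<bar> + \<bar>m - l\<bar> \<le> int t} \<subseteq> K0"
  shows "informed D l (Suc t) (K0 \<union> gather (neighbours (cells D) (know T D t) (pos D l)))"
proof -
  let ?G = "gather (neighbours (cells D) (know T D t) (pos D l))"
  have 1: "?G \<subseteq> fact_at D ` {m \<in> {lo D..hi D}. \<bar>m\<bar> \<le> int t + 1}"
  proof
    fix w assume "w \<in> ?G"
    then obtain i x t' K where K: "w \<in> K" "neighbours (cells D) (know T D t) (pos D l) i = Some (Some (x, t', K))"
      unfolding gather_def by blast
    from neighbours_SomeD[OF D l K(2)] obtain m where m: "m \<in> {lo D..hi D}" "Some (x, t', K) = know T D t (pos D m)"
      by metis
    then have "informed D m t K" using s unfolding sound_at_def by (metis (no_types, lifting) Pair_inject option.distinct(1) option.inject)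
    then show "w \<in> fact_at D ` {m \<in> {lo D..hi D}. \<bar>m\<bar> \<le> int t + 1}"
      using K(1) unfolding informed_def by force
  qed
  have 2: "fact_at D m \<in> K0 \<union> ?G" if m: "m \<in> {lo D..hi D}" "\<bar>m\<bar> + \<bar>m - l\<bar> \<le> int t + 1" for m
  proof (cases "\<bar>m\<bar> + \<bar>m - l\<bar> \<le> int t")
    case True
    then show ?thesis using K0(3) m by blast
  next
    case False
    show ?thesis
    proof (cases "m = l")
      case True
      then show ?thesis using False m K0(2) by simp
    next
      case ne: False
      define k where "k = (if m > l then l + 1 else l - 1)"
      have k: "k \<in> {lo D..hi D}" "\<bar>k - l\<bar> = 1" "\<bar>m\<bar> + \<bar>m - k\<bar> \<le> int t"
        using ne m l unfolding k_def by auto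
      then have "\<bar>k\<bar> \<le> int t" by linarith
      then obtain K where K: "know T D t (pos D k) = Some (pos D k, t, K)" "informed D k t K"
        using s k(1) unfolding sound_at_def by metis
      obtain i where "neighbours (cells D) (know T D t) (pos D l) i = Some (Some (pos D k, t, K))"
        using neighbours_ex[OF D l k(1,2)] K(1) by metis
      then have "K \<subseteq> ?G" unfolding gather_def by blast
      moreover have "fact_at D m \<in> K" using K(2) k(3) m(1) unfolding informed_def by blast
      ultimately show ?thesis by blast
    qed
  qed
  have e: "int (Suc t) = int t + 1" by simp
  show ?thesis unfolding informed_def e using 1 2 K0(1) by blast
qed

lemma sound_at:
  assumes D: "is_config D"
  shows "t \<le> T \<Longrightarrow> sound_at T D t"
proof (induction t)
  case 0
  have z: "pos D 0 = (0,0)" "0 \<in> {lo D..hi D}" using config_zero[OF D] by auto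
  have "pos D l \<noteq> (0,0)" if "l \<in> {lo D..hi D}" "l \<noteq> 0" for l
    using config_inj[OF D that(1) z(2)] z that(2) by auto
  then have other: "know T D 0 (pos D l) = None" if "l \<in> {lo D..hi D}" "l \<noteq> 0" for l
    using that by simp
  have "{m \<in> {lo D..hi D}. \<bar>m\<bar> \<le> 0} = {0}" "{m \<in> {lo D..hi D}. \<bar>m\<bar> + \<bar>m\<bar> \<le> 0} = {0}" using z(2) by auto
  then have "informed D 0 0 {fact_at D 0}" unfolding informed_def by simp
  moreover have "know T D 0 (pos D 0) = Some (pos D 0, 0, {fact_at D 0})"
    using z by (simp add: knowledge_init_def fact_at_def)
  ultimately have "\<exists>K. know T D 0 (pos D 0) = Some (pos D 0, 0, K) \<and> informed D 0 0 K" by blast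
  with other show ?case unfolding sound_at_def by (metis abs_le_zero_iff of_nat_0)
next
  case (Suc t)
  then have s: "sound_at T D t" and tT: "t < T" by simp_all
  show ?case unfolding sound_at_def
  proof
    fix l assume l: "l \<in> {lo D..hi D}"
    let ?nb = "neighbours (cells D) (know T D t) (pos D l)"
    have rule: "know T D (Suc t) (pos D l) = knowledge_rule T (know T D t (pos D l)) ?nb" by simp
    have finish: "\<exists>K. know T D (Suc t) (pos D l) = Some (pos D l, Suc t, K) \<and> informed D l (Suc t) K"
      if "knowledge_step T (know T D t (pos D l)) ?nb = Some (pos D l, Suc t, K)" "informed D l (Suc t) K"
        "\<bar>l\<bar> \<le> int (Suc t)" for K
      using informed_states[OF D l that(3) Suc.prems that(2)] that(1,2) rule
      unfolding knowledge_rule_def by simp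
    \<comment> \<open>All informants agree, so the choice made by \<open>wake\<close> is
      harmless.\<close>
    have inf: "pos D l = padd x (eps (opp i)) \<and> t' = t" if w: "(i, x, t') \<in> informants T ?nb" for i x t'
    proof -
      obtain K where K: "?nb i = Some (Some (x, t', K))" using w unfolding informants_def by blast
      from neighbours_SomeD[OF D l K] obtain m where m: "m \<in> {lo D..hi D}" "i < 4"
        "Some (x, t', K) = know T D t (pos D m)" "padd (pos D l) (eps i) = pos D m" by metis
      then have "x = pos D m" "t' = t"
        using s unfolding sound_at_def by (metis (no_types, lifting) Pair_inject option.distinct(1) option.inject)+
      then show ?thesis using m padd_opp[of i x "pos D l"] by simp
    qed
    have awake_nb: "informants T ?nb \<noteq> {} \<longleftrightarrow> (\<exists>k\<in>{lo D..hi D}. \<bar>k - l\<bar> = 1 \<and> \<bar>k\<bar> \<le> int t)"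
    proof
      assume "informants T ?nb \<noteq> {}"
      then obtain i x t' K where K: "?nb i = Some (Some (x, t', K))" unfolding informants_def by blast
      from neighbours_SomeD[OF D l K] obtain m where m: "m \<in> {lo D..hi D}" "\<bar>m - l\<bar> = 1"
        "Some (x, t', K) = know T D t (pos D m)" by metis
      then show "\<exists>k\<in>{lo D..hi D}. \<bar>k - l\<bar> = 1 \<and> \<bar>k\<bar> \<le> int t"
        using s unfolding sound_at_def by (metis option.distinct(1))
    next
      assume "\<exists>k\<in>{lo D..hi D}. \<bar>k - l\<bar> = 1 \<and> \<bar>k\<bar> \<le> int t"
      then obtain k where k: "k \<in> {lo D..hi D}" "\<bar>k - l\<bar> = 1" "\<bar>k\<bar> \<le> int t" by blast
      then obtain K where K: "know T D t (pos D k) = Some (pos D k, t, K)"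
        using s unfolding sound_at_def by metis
      obtain i where "i < 4" "?nb i = Some (Some (pos D k, t, K))"
        using neighbours_ex[OF D l k(1,2)] K(1) by metis
      then show "informants T ?nb \<noteq> {}" using tT unfolding informants_def by blast
    qed
    \<comment> \<open>The node is already awake, is being woken in this step, or stays
      asleep.\<close>
    consider "\<bar>l\<bar> \<le> int t" | "\<bar>l\<bar> = int t + 1" | "\<bar>l\<bar> > int t + 1" by linarith
    then show "if \<bar>l\<bar> \<le> int (Suc t)
       then \<exists>K. know T D (Suc t) (pos D l) = Some (pos D l, Suc t, K) \<and> informed D l (Suc t) K
       else know T D (Suc t) (pos D l) = None"
    proof cases
      case 1
      then obtain K where K: "know T D t (pos D l) = Some (pos D l, t, K)" "informed D l t K"
        using s l unfolding sound_at_def by metis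
      have "informed D l (Suc t) (K \<union> gather ?nb)"
        using K(2) 1 by (intro informed_gather[OF D l s]) (auto simp: informed_def)
      then show ?thesis using finish[of "K \<union> gather ?nb"] 1 tT K(1) by (simp add: knowledge_step_def)
    next
      case 2
      then have N: "know T D t (pos D l) = None" using s l unfolding sound_at_def by auto
      define k where "k = (if l > 0 then l - 1 else l + 1)"
      have "k \<in> {lo D..hi D}" "\<bar>k - l\<bar> = 1" "\<bar>k\<bar> \<le> int t"
        using 2 l config_zero[OF D] unfolding k_def by auto
      then have ne: "informants T ?nb \<noteq> {}" using awake_nb by blast
      obtain i x t' where w: "(SOME w. w \<in> informants T ?nb) = (i, x, t')" "(i, x, t') \<in> informants T ?nb"
        using ne by (metis prod_cases3 some_in_eq)
      then have "wake T ?nb = Some (pos D l, Suc t, insert (fact_at D l) (gather ?nb))"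
        using ne inf[OF w(2)] unfolding wake_def fact_at_def bc_nb by simp
      moreover have "informed D l (Suc t) ({fact_at D l} \<union> gather ?nb)"
        using 2 l by (intro informed_gather[OF D l s]) auto
      ultimately show ?thesis using finish[of "insert (fact_at D l) (gather ?nb)"] 2 N
        by (simp add: knowledge_step_def)
    next
      case 3
      then have N: "know T D t (pos D l) = None" using s l unfolding sound_at_def by auto
      have "informants T ?nb = {}" using awake_nb 3 by fastforce
      then show ?thesis using N 3 by (simp add: knowledge_rule_def knowledge_step_def wake_def)
    qed
  qed
qed

text \<open>Pins a clock value \<open>T\<close> to time \<open>T\<close>, so that the added firing
  condition can apply at no other time.\<close>

lemma know_clock: "know T D t x = Some (y, t', K) \<Longrightarrow> t' = t \<and> t \<le> T"
proof (induction t arbitrary: x y t' K)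
  case 0
  then show ?case by (simp add: knowledge_init_def split: if_splits)
next
  case (Suc t)
  let ?c = "know T D t x" and ?nb = "neighbours (cells D) (know T D t) x"
  have s: "knowledge_step T ?c ?nb = Some (y, t', K)"
  proof -
    have "knowledge_rule T ?c ?nb = Some (y, t', K)" using Suc.prems by simp
    then show ?thesis unfolding knowledge_rule_def by (simp split: if_splits)
  qed
  show ?case
  proof (cases ?c)
    case None
    then have w: "wake T ?nb = Some (y, t', K)" using s by (simp add: knowledge_step_def)
    then have ne: "informants T ?nb \<noteq> {}" unfolding wake_def by auto
    then obtain i x' u where u: "(SOME w. w \<in> informants T ?nb) = (i, x', u)" "(i, x', u) \<in> informants T ?nb"
      by (metis prod_cases3 some_in_eq)
    then obtain K' where "?nb i = Some (Some (x', u, K'))" "u < T" unfolding informants_def by blast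
    then have "u = t" "t < T" using Suc.IH unfolding neighbours_def by (metis option.distinct(1) option.inject)+
    then show ?thesis using w ne u(1) unfolding wake_def by simp
  next
    case (Some c)
    then obtain x' u K' where c: "?c = Some (x', u, K')" by (cases c) auto
    then have "u = t" using Suc.IH by blast
    then show ?thesis using s c unfolding knowledge_step_def by (simp split: if_splits)
  qed
qed

section \<open>Upper bound\<close>

lemma fires_at_unique:
  assumes "is_config D" "fires_at A D t" "fires_at A D t'"
  shows "t = t'"
proof -
  have "pos D 0 \<in> cells D" using config_zero[OF assms(1)] by (intro pos_in_cells) simp
  then show ?thesis using assms(2,3) unfolding fires_at_def by (metis linorder_neqE_nat)
qed

lemma ft_eq: "is_config D \<Longrightarrow> fires_at A D t \<Longrightarrow> ft D A = t"
  unfolding ft_def using fires_at_unique by (intro the_equality) blast+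

lemma fires_at_ft:
  assumes "is_solution A" "is_config D" shows "fires_at A D (ft D A)"
proof -
  obtain t where "fires_at A D t" using assms unfolding is_solution_def by blast
  then show ?thesis using ft_eq[OF assms(2)] by simp
qed

lemma mft_le_ft: "is_solution A \<Longrightarrow> mft D \<le> ft D A"
  unfolding mft_def by (intro cInf_lower) auto

text \<open>\<open>solution_exists\<close> makes the set of firing times nonempty, which a lower
  bound on its infimum requires.\<close>

lemma mft_geI:
  assumes "\<And>A. is_solution A \<Longrightarrow> T \<le> ft D A" shows "T \<le> mft D"
  unfolding mft_def using assms solution_exists by (intro cInf_greatest) auto

lemma automaton_gen: "is_automaton A \<Longrightarrow> gen A (tau A b) \<in> states A"
  unfolding is_automaton_def by blast

lemma automaton_delta:
  assumes "is_automaton A" "x \<in> states A" "\<And>i. i < 4 \<Longrightarrow> nb i \<in> insert None (Some ` states A)"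
  shows "delta A x (nb (0::nat)) (nb 1) (nb 2) (nb 3) \<in> states A"
proof -
  let ?N = "insert None (Some ` states A)"
  have "\<forall>x\<in>states A. \<forall>a\<in>?N. \<forall>b\<in>?N. \<forall>c\<in>?N. \<forall>d\<in>?N. delta A x a b c d \<in> states A"
    using assms(1) unfolding is_automaton_def by blast
  moreover have "nb 0 \<in> ?N" "nb 1 \<in> ?N" "nb 2 \<in> ?N" "nb 3 \<in> ?N" by (intro assms(3); simp)+
  ultimately show ?thesis using assms(2) by blast
qed

lemma automaton_quiet:
  assumes "is_automaton A" "\<And>i. i < 4 \<Longrightarrow> nb i \<in> {None, Some (quiescent A)}"
  shows "delta A (quiescent A) (nb (0::nat)) (nb 1) (nb 2) (nb 3) = quiescent A"
proof -
  have "\<forall>a\<in>{None, Some (quiescent A)}. \<forall>b\<in>{None, Some (quiescent A)}.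
        \<forall>c\<in>{None, Some (quiescent A)}. \<forall>d\<in>{None, Some (quiescent A)}.
        delta A (quiescent A) a b c d = quiescent A" using assms(1) unfolding is_automaton_def by blast
  moreover have "nb i \<in> {None, Some (quiescent A)}" if "i < 4" for i by (rule assms(2)[OF that])
  then have "nb 0 \<in> {None, Some (quiescent A)}" "nb 1 \<in> {None, Some (quiescent A)}"
    "nb 2 \<in> {None, Some (quiescent A)}" "nb 3 \<in> {None, Some (quiescent A)}" by simp_all
  ultimately show ?thesis by blast
qed

lemma run_states:
  assumes "is_automaton A" shows "run A P t x \<in> states A"
proof (induction t arbitrary: x)
  case 0
  have "quiescent A \<in> states A" using assms unfolding is_automaton_def by blast
  then show ?case using automaton_gen[OF assms] by simp
next
  case (Suc t)
  show ?case unfolding run.simps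
    by (rule automaton_delta[OF assms Suc]) (simp add: nbr_def Suc)
qed

definition product_rule :: "automaton \<Rightarrow> nat \<Rightarrow> (nat \<times> knowledge) local_rule" where
  "product_rule A T c nb = (let a = (\<lambda>i. map_option fst (nb i)) in
     (delta A (fst c) (a 0) (a 1) (a 2) (a 3), knowledge_rule T (snd c) (\<lambda>i. map_option snd (nb i))))"

lemma evolve_product:
  "evolve (product_rule A T) (quiescent A, None) (\<lambda>b. (gen A (tau A b), knowledge_init b)) P t x
     = (run A P t x, evolve (knowledge_rule T) None knowledge_init P t x)"
proof (induction t arbitrary: x)
  case 0 then show ?case by simp
next
  case (Suc t)
  define e where "e = evolve (product_rule A T) (quiescent A, None) (\<lambda>b. (gen A (tau A b), knowledge_init b)) P t"
  have e: "e y = (run A P t y, evolve (knowledge_rule T) None knowledge_init P t y)" for y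
    unfolding e_def by (rule Suc)
  have a: "map_option fst (neighbours P e x i) = nbr P (run A P t) x i" if "i < 4" for i
    using that e unfolding neighbours_def nbr_def by simp
  have b: "(\<lambda>i. map_option snd (neighbours P e x i)) = neighbours P (evolve (knowledge_rule T) None knowledge_init P t) x"
    using e unfolding neighbours_def by (intro ext) simp
  show ?case unfolding evolve.simps e_def[symmetric]
    unfolding product_rule_def Let_def b using e[of x] a[of 0] a[of 1] a[of 2] a[of 3] by simp
qed

text \<open>The fact set \<open>F\<close> is built into the firing states. The quiescent pair holds
  no knowledge, so it does not become a firing state.\<close>

lemma product_automaton:
  assumes A: "is_automaton A"
  obtains B where "is_automaton B"
    "\<And>P t x. run B P t x \<in> firing B \<longleftrightarrow> run A P t x \<in> firing A \<or>
       (\<exists>y K. evolve (knowledge_rule T) None knowledge_init P t x = Some (y, T, K) \<and> F \<subseteq> K)"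
proof -
  define S where "S = states A \<times> knowledge_states T"
  define G where "G = (\<lambda>b. (gen A (tau A b), knowledge_init b))"
  define H where "H = {w \<in> S. fst w \<in> firing A \<or> (\<exists>y K. snd w = Some (y, T, K) \<and> F \<subseteq> K)}"
  have "\<exists>B. is_automaton B \<and> (\<forall>P t x. run B P t x \<in> firing B \<longleftrightarrow>
     evolve (product_rule A T) (quiescent A, None) G P t x \<in> H)"
  proof (rule realize_automaton)
    show "finite S" unfolding S_def using A finite_knowledge_states unfolding is_automaton_def by blast
    show "(quiescent A, None) \<in> S" using A unfolding S_def is_automaton_def knowledge_states_def by blast
    show "G b \<in> S" for b using automaton_gen[OF A] knowledge_init_states unfolding G_def S_def by simp
    show "H \<subseteq> S" "(quiescent A, None) \<notin> H" using A unfolding H_def is_automaton_def by simp_all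
  next
    fix s and nb :: "nat \<Rightarrow> (nat \<times> knowledge) option"
    assume s: "s \<in> S" and nb: "\<And>i y. nb i = Some y \<Longrightarrow> y \<in> S"
    have "map_option fst (nb i) \<in> insert None (Some ` states A)" for i
      using nb[of i] unfolding S_def by (cases "nb i") auto
    then have "fst (product_rule A T s nb) \<in> states A"
      using automaton_delta[OF A, of "fst s" "\<lambda>i. map_option fst (nb i)"] s unfolding product_rule_def Let_def fst_conv S_def
      by (simp add: mem_Times_iff)
    moreover have "snd (product_rule A T s nb) \<in> knowledge_states T"
      unfolding product_rule_def Let_def by (simp add: knowledge_rule_closed)
    ultimately show "product_rule A T s nb \<in> S" unfolding S_def by (simp add: mem_Times_iff)
  next
    fix nb :: "nat \<Rightarrow> (nat \<times> knowledge) option"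
    assume nb: "\<And>i y. nb i = Some y \<Longrightarrow> y = (quiescent A, None)"
    have "map_option fst (nb i) \<in> {None, Some (quiescent A)}" for i
      using nb[of i] by (cases "nb i") auto
    moreover have "knowledge_rule T None (\<lambda>i. map_option snd (nb i)) = None"
      using nb by (intro knowledge_rule_quiet) auto
    ultimately show "product_rule A T (quiescent A, None) nb = (quiescent A, None)"
      using automaton_quiet[OF A, of "\<lambda>i. map_option fst (nb i)"] unfolding product_rule_def Let_def by simp
  qed
  then obtain B where B: "is_automaton B" "\<And>P t x. run B P t x \<in> firing B \<longleftrightarrow>
     evolve (product_rule A T) (quiescent A, None) G P t x \<in> H" by blast
  have k: "evolve (knowledge_rule T) None knowledge_init P t x \<in> knowledge_states T" for P t x
  proof (cases t)
    case 0
    then show ?thesis using knowledge_init_states by (simp add: knowledge_states_def)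
  qed (simp add: knowledge_rule_closed)
  show thesis
  proof (rule that[OF B(1)])
    show "run B P t x \<in> firing B \<longleftrightarrow> run A P t x \<in> firing A \<or>
       (\<exists>y K. evolve (knowledge_rule T) None knowledge_init P t x = Some (y, T, K) \<and> F \<subseteq> K)" for P t x
      unfolding B(2) G_def evolve_product H_def S_def using run_states[OF A] k by simp
  qed
qed

text \<open>The solution constructed here overrides an arbitrary solution at time \<open>T\<close> on exactly those
  configurations whose facts include \<open>F\<close>.\<close>
lemma mft_le:
  assumes C: "is_config C" "F \<subseteq> facts C"
    and early: "\<And>D l m. is_config D \<Longrightarrow> F \<subseteq> facts D \<Longrightarrow> l \<in> {lo D..hi D} \<Longrightarrow> m \<in> {lo D..hi D} \<Longrightarrow>
      fact_at D m \<in> F \<Longrightarrow> \<bar>m\<bar> + \<bar>m - l\<bar> \<le> int T"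
    and zero: "fact_at C 0 \<in> F"
  shows "mft C \<le> T"
proof -
  obtain A where A: "is_solution A" using solution_exists by blast
  then have aut: "is_automaton A" unfolding is_solution_def by blast
  obtain B where B: "is_automaton B"
    "\<And>P t x. run B P t x \<in> firing B \<longleftrightarrow> run A P t x \<in> firing A \<or>
       (\<exists>y K. evolve (knowledge_rule T) None knowledge_init P t x = Some (y, T, K) \<and> F \<subseteq> K)"
    using product_automaton[OF aut] by blast
  define hit where "hit D t x \<longleftrightarrow> (\<exists>y K. know T D t x = Some (y, T, K) \<and> F \<subseteq> K)" for D t x
  have hitB: "run B (cells D) t x \<in> firing B \<longleftrightarrow> run A (cells D) t x \<in> firing A \<or> hit D t x" for D t x
    using B(2) unfolding hit_def .
  have hit_T: "hit D t x \<Longrightarrow> t = T" for D t x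
    unfolding hit_def using know_clock by blast
  have hit_sound: "F \<subseteq> facts D" if D: "is_config D" and x: "x \<in> cells D" and h: "hit D t x" for D t x
  proof -
    obtain l where l: "l \<in> {lo D..hi D}" "x = pos D l" using x unfolding cells_def by blast
    obtain y K where K: "know T D T x = Some (y, T, K)" "F \<subseteq> K" using h hit_T[OF h] unfolding hit_def by blast
    then obtain K' where "know T D T x = Some (pos D l, T, K')" "informed D l T K'"
      using sound_at[OF D order_refl, of T] l unfolding sound_at_def by (metis option.distinct(1))
    then have "K \<subseteq> facts D" using K unfolding informed_def facts_def by auto
    then show ?thesis using K by blast
  qed
  have hit_complete: "hit D T x" if D: "is_config D" and x: "x \<in> cells D" and F: "F \<subseteq> facts D" for D x
  proof -
    obtain l where l: "l \<in> {lo D..hi D}" "x = pos D l" using x unfolding cells_def by blast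
    obtain m0 where m0: "m0 \<in> {lo D..hi D}" "fact_at D m0 = fact_at C 0" using zero F unfolding facts_def by auto
    then have "pos D m0 = pos D 0" using config_zero[OF D] config_zero[OF C(1)] unfolding fact_at_def by simp
    then have "m0 = 0" using config_inj[OF D m0(1)] config_zero[OF D] by simp
    \<comment> \<open>The general's own fact in \<open>F\<close> turns \<open>early\<close> into the
      statement that every node is awake by time \<open>T\<close>.\<close>
    then have "\<bar>l\<bar> \<le> int T" using early[OF D F l(1) m0(1)] m0 zero by simp
    then obtain K where K: "know T D T x = Some (pos D l, T, K)" "informed D l T K"
      using sound_at[OF D order_refl, of T] l unfolding sound_at_def by metis
    have "F \<subseteq> K"
    proof
      fix w assume w: "w \<in> F"
      then obtain m where m: "m \<in> {lo D..hi D}" "w = fact_at D m" using F unfolding facts_def by blast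
      then have "\<bar>m\<bar> + \<bar>m - l\<bar> \<le> int T" using early[OF D F l(1)] w by simp
      then show "w \<in> K" using K(2) m unfolding informed_def by blast
    qed
    then show ?thesis using K unfolding hit_def by blast
  qed
  have fires: "fires_at B D (if F \<subseteq> facts D then min T (ft D A) else ft D A)" if D: "is_config D" for D
  proof -
    note f = fires_at_ft[OF A D]
    show ?thesis
    proof (cases "F \<subseteq> facts D")
      case True
      have "hit D t x \<longleftrightarrow> t = T" if "x \<in> cells D" for t x
        using hit_T hit_complete[OF D that True] by blast
      then show ?thesis using True f unfolding fires_at_def hitB
        by (auto simp: min_def)
    next
      case False
      then have "\<not> hit D t x" if "x \<in> cells D" for t x using hit_sound[OF D that] by blast
      then show ?thesis using False f unfolding fires_at_def hitB by auto
    qed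
  qed
  then have "is_solution B" using B(1) unfolding is_solution_def by blast
  then have "mft C \<le> ft C B" by (rule mft_le_ft)
  also have "ft C B = min T (ft C A)" using ft_eq[OF C(1) fires[OF C(1)]] C(2) by simp
  finally show ?thesis by simp
qed

section \<open>Lower bound\<close>

lemma reverse_simps [simp]:
  "lo (reverse D) = - hi D" "hi (reverse D) = - lo D" "pos (reverse D) l = pos D (- l)"
  unfolding reverse_def by simp_all

definition agree :: "config \<Rightarrow> config \<Rightarrow> int \<Rightarrow> int \<Rightarrow> bool" where
  "agree D E i j \<longleftrightarrow> lo D \<le> i \<and> lo E \<le> i \<and> i \<le> 0 \<and> 0 \<le> j \<and> j \<le> hi D \<and> j \<le> hi E \<and>
     (\<forall>l\<in>{i..j}. pos E l = pos D l \<and> bc (cells E) (pos D l) = bc (cells D) (pos D l))"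

text \<open>Facts carry no indices. The code at \<open>lo C\<close> makes that position an end of
  \<open>D\<close>, the codes then force the path step by step, and the general at the origin fixes
  the offset; only the orientation stays open.\<close>

lemma align:
  assumes C: "is_config C" and D: "is_config D" and j: "0 \<le> j" "j \<le> hi C"
    and F: "fact_at C ` {lo C..j} \<subseteq> facts D"
  obtains E where "E = D \<or> E = reverse D" "is_config E" "lo E = lo C" "agree C E (lo C) j"
proof -
  have sub: "pos C l \<in> cells D \<and> bc (cells D) (pos C l) = bc (cells C) (pos C l)" if "l \<in> {lo C..j}" for l
  proof -
    have "fact_at C l \<in> facts D" using F that by blast
    then obtain m where "m \<in> {lo D..hi D}" "fact_at C l = fact_at D m" unfolding facts_def by blast
    then show ?thesis using pos_in_cells unfolding fact_at_def by (metis Pair_inject)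
  qed
  have nbh: "y \<in> cells D \<longleftrightarrow> y \<in> cells C" if "l \<in> {lo C..j}" "adjacent (pos C l) y" for l y
    using sub[OF that(1)] that(2) bc_eq_iff by blast
  have r: "lo C \<in> {lo C..j}" "lo C \<in> {lo C..hi C}" using config_zero[OF C] j by auto
  then obtain k where k: "k \<in> {lo D..hi D}" "pos C (lo C) = pos D k"
    using sub unfolding cells_def by blast
  \<comment> \<open>An inner node has two neighbours, but the code at \<open>lo C\<close> allows at
    most the position at \<open>lo C + 1\<close>.\<close>
  have "k = lo D \<or> k = hi D"
  proof (rule ccontr)
    assume "\<not> (k = lo D \<or> k = hi D)"
    then have k1: "k - 1 \<in> {lo D..hi D}" "k + 1 \<in> {lo D..hi D}" using k by auto
    have "pos D m = pos C (lo C + 1)" if "m \<in> {lo D..hi D}" "\<bar>k - m\<bar> = 1" for m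
    proof -
      have "adjacent (pos C (lo C)) (pos D m)" using config_adjacent_iff[OF D k(1) that(1)] that(2) k(2) by simp
      moreover from this have "pos D m \<in> cells C" using nbh[OF r(1)] pos_in_cells[OF that(1)] by blast
      ultimately show ?thesis using adjacent_cell[OF C r(2)] by (metis less_add_one diff_less_eq not_less zero_less_one)
    qed
    then have "pos D (k - 1) = pos D (k + 1)" using k1 by simp
    then show False using config_inj[OF D k1] by simp
  qed
  then obtain E where E: "E = D \<or> E = reverse D" "pos E (lo E) = pos C (lo C)"
    using k(2) by (metis reverse_simps(1,3) add.inverse_inverse)
  have Ec: "is_config E" "cells E = cells D" using E(1) D is_config_reverse cells_reverse by auto
  \<comment> \<open>Walking away from the common left end: the next cell of \<open>C\<close> lies in
    \<open>E\<close> by the codes, and injectivity excludes turning back.\<close>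
  have step: "lo C + int n \<le> j \<longrightarrow> lo E + int n \<le> hi E \<and> pos E (lo E + int n) = pos C (lo C + int n)" for n
  proof (induction n rule: less_induct)
    case (less n)
    show ?case
    proof (cases n)
      case 0
      then show ?thesis using E(2) config_zero[OF Ec(1)] by simp
    next
      case (Suc n')
      show ?thesis
      proof
        assume n: "lo C + int n \<le> j"
        define l k where "l = lo C + int n'" and "k = lo E + int n'"
        have k: "k \<in> {lo E..hi E}" "pos E k = pos C l"
          using less[of n'] Suc n unfolding l_def k_def by auto
        have l: "l \<in> {lo C..hi C}" "l + 1 \<in> {lo C..hi C}" "l \<in> {lo C..j}"
          using n Suc j unfolding l_def by auto
        have a: "adjacent (pos C l) (pos C (l+1))" using config_adjacent_iff[OF C l(1,2)] by simp
        then have "pos C (l+1) \<in> cells E" using nbh[OF l(3)] pos_in_cells[OF l(2)] Ec by blast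
        then have "k + 1 \<le> hi E \<and> pos C (l+1) = pos E (k+1)"
        proof (rule adjacent_cell[OF Ec(1) k(1)])
          show "adjacent (pos E k) (pos C (l+1))" using a k by simp
        next
          assume b: "lo E \<le> k - 1" "pos C (l+1) = pos E (k-1)"
          then obtain n'' where n'': "n' = Suc n''" unfolding k_def by (cases n') auto
          then have "pos E (k-1) = pos C (l-1)"
            using less[of n''] Suc n unfolding k_def l_def by simp
          then have "l + 1 = l - 1" using b n'' l(1) n by (intro config_inj[OF C l(2)]) (auto simp: l_def)
          then show ?thesis by simp
        qed blast
        then show "lo E + int n \<le> hi E \<and> pos E (lo E + int n) = pos C (lo C + int n)"
          using Suc unfolding k_def l_def by (simp add: algebra_simps)
      qed
    qed
  qed
  have z: "lo C \<le> 0" "pos C 0 = (0,0)" "lo E \<le> 0" "0 \<le> hi E" "pos E 0 = (0,0)"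
    using config_zero[OF C] config_zero[OF Ec(1)] by auto
  have "lo E - lo C \<le> hi E" "pos E (lo E - lo C) = pos E 0" using step[of "nat (- lo C)"] z j by simp_all
  then have "lo E - lo C = 0" using z by (intro config_inj[OF Ec(1)]) auto
  then have lo: "lo E = lo C" by simp
  have "pos E l = pos C l" "l \<le> hi E" if "l \<in> {lo C..j}" for l
    using step[of "nat (l - lo C)"] that lo by simp_all
  then have "agree C E (lo C) j" unfolding agree_def using sub Ec lo z j by auto
  then show thesis using that E(1) Ec(1) lo by blast
qed

text \<open>The part of \<open>E\<close> beyond \<open>j\<close> is an admissible right extension,
  so \<open>g\<close> bounds its length.\<close>

lemma agree_W:
  assumes C: "is_config C" and E: "is_config E" and lo: "lo E = lo C" and ag: "agree C E (lo C) j"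
  shows "([], map (pos E) [j+1..hi E]) \<in> W C (lo C) j"
proof -
  let ?X = "extend C (lo C) j [] (map (pos E) [j+1..hi E])"
  have j: "0 \<le> j" "j \<le> hi E" using ag unfolding agree_def by auto
  have "lo ?X = lo E" "hi ?X = hi E" using lo j unfolding extend_def by simp_all
  moreover have "pos ?X l = pos E l" if "lo E \<le> l" "l \<le> hi E" for l
    using that lo ag j unfolding extend_def agree_def by simp
  ultimately have "is_config ?X" "cells ?X = cells E" using is_config_cong[OF E, of ?X] by auto
  then show ?thesis using ag unfolding W_def agree_def by simp
qed

lemma length_le_g: "(x0, x1) \<in> W C i j \<Longrightarrow> enat (length x1) \<le> g C i j"
  unfolding g_def V_def by (force intro: SUP_upper2)

text \<open>\<open>T1\<close> lets the left end learn the fact at \<open>j\<close>;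
  \<open>T2\<close> lets any possible right end \<open>h\<close> learn the fact at
  \<open>lo C\<close>. No other pair of node and fact takes longer than these two.\<close>

lemma mft_le_known:
  assumes C: "is_config C" and j: "0 \<le> j" "j \<le> hi C"
    and T1: "2 * j - lo C \<le> int T"
    and T2: "\<And>h. j \<le> h \<Longrightarrow> enat (nat (h - j)) \<le> g C (lo C) j \<Longrightarrow> h - 2 * lo C \<le> int T"
  shows "mft C \<le> T"
proof (rule mft_le[where F = "fact_at C ` {lo C..j}"])
  show "fact_at C ` {lo C..j} \<subseteq> facts C" using j unfolding facts_def by auto
  show "fact_at C 0 \<in> fact_at C ` {lo C..j}" using config_zero[OF C] j by auto
next
  fix D l m
  assume D: "is_config D" and F: "fact_at C ` {lo C..j} \<subseteq> facts D"
    and l: "l \<in> {lo D..hi D}" and m: "m \<in> {lo D..hi D}" and mF: "fact_at D m \<in> fact_at C ` {lo C..j}"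
  obtain E where E: "E = D \<or> E = reverse D" "is_config E" "lo E = lo C" "agree C E (lo C) j"
    using align[OF C D j F] by blast
  have hj: "j \<le> hi E" using E(4) unfolding agree_def by blast
  have "enat (nat (hi E - j)) \<le> g C (lo C) j"
    using length_le_g[OF agree_W[OF C E(2-4)]] hj by simp
  then have T2': "hi E - 2 * lo C \<le> int T" using T2 hj by blast
  obtain m' where m': "m' \<in> {lo C..j}" "pos D m = pos C m'" using mF unfolding fact_at_def by auto
  have b: "\<bar>m'\<bar> + \<bar>m' - l'\<bar> \<le> int T" if "l' \<in> {lo E..hi E}" for l'
  proof -
    have "lo C \<le> l'" "l' \<le> hi E" "lo C \<le> m'" "m' \<le> j" using that m'(1) E(3) by auto
    then show ?thesis using T1 T2' hj j config_zero[OF C] by linarith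
  qed
  have pm: "pos E m' = pos D m" using E(4) m' unfolding agree_def by simp
  have m'E: "m' \<in> {lo E..hi E}" using m'(1) E(3) hj by simp
  from E(1) show "\<bar>m\<bar> + \<bar>m - l\<bar> \<le> int T"
  proof
    assume ED: "E = D"
    then have "m = m'" using config_inj[OF D m] m'E pm by simp
    then show ?thesis using b l ED by simp
  next
    assume ED: "E = reverse D"
    then have "- m' = m" using config_inj[OF D _ m] m'E pm by simp
    then show ?thesis using b[of "- l"] l ED by auto
  qed
qed (rule C)

section \<open>Light cones: quiescence and agreement of runs\<close>

lemma run_quiescent:
  assumes "is_automaton A" "is_config D"
  shows "l \<in> {lo D..hi D} \<Longrightarrow> int t < \<bar>l\<bar> \<Longrightarrow> run A (cells D) t (pos D l) = quiescent A"
proof (induction t arbitrary: l)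
  case 0
  have "pos D l \<noteq> pos D 0" using config_inj[OF assms(2) 0(1), of 0] config_zero[OF assms(2)] 0 by auto
  then show ?case using config_zero[OF assms(2)] by simp
next
  case (Suc t)
  have "nbr (cells D) (run A (cells D) t) (pos D l) i \<in> {None, Some (quiescent A)}" if "i < 4" for i
  proof (cases "padd (pos D l) (eps i) \<in> cells D")
    case True
    from adjacent_cell[OF assms(2) Suc.prems(1) this padd_eps_adjacent[OF that]]
    obtain k where "k \<in> {lo D..hi D}" "padd (pos D l) (eps i) = pos D k" "\<bar>k - l\<bar> = 1"
      using Suc.prems(1) by (smt (verit) atLeastAtMost_iff)
    then show ?thesis using Suc.IH[of k] Suc.prems(2) unfolding nbr_def by auto
  qed (simp add: nbr_def)
  then show ?case using Suc automaton_quiet[OF assms(1), of "nbr (cells D) (run A (cells D) t) (pos D l)"] by simp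
qed

text \<open>Cell \<open>i - 1\<close> can leave quiescence at time \<open>1 - i\<close> at the
  earliest, and its influence needs \<open>l - (i - 1)\<close> further steps to reach
  \<open>l\<close>; hence the bound \<open>l - 2 * (i - 1)\<close>, and symmetrically on the right.
  An end of \<open>D\<close> imposes no bound.\<close>

lemma run_agree:
  assumes A: "is_automaton A" and D: "is_config D" and E: "is_config E" and ag: "agree D E i j"
  shows "l \<in> {i..j} \<Longrightarrow> i = lo D \<or> int t < l - 2 * (i - 1) \<Longrightarrow> j = hi D \<or> int t < 2 * (j + 1) - l \<Longrightarrow>
    run A (cells E) t (pos D l) = run A (cells D) t (pos D l)"
proof (induction t arbitrary: l)
  case 0
  have "0 \<in> {i..j}" "pos D 0 = (0,0)" using ag config_zero[OF D] unfolding agree_def by auto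
  then have "bc (cells E) (0,0) = bc (cells D) (0,0)" using ag unfolding agree_def by metis
  then show ?case by simp
next
  case (Suc t)
  have lD: "l \<in> {lo D..hi D}" "l \<in> {lo E..hi E}" using Suc.prems(1) ag unfolding agree_def by auto
  have pl: "pos E l = pos D l" "bc (cells E) (pos D l) = bc (cells D) (pos D l)"
    using ag Suc.prems(1) unfolding agree_def by auto
  have ij: "i \<le> 0" "0 \<le> j" using ag unfolding agree_def by auto
  have "nbr (cells E) (run A (cells E) t) (pos D l) d = nbr (cells D) (run A (cells D) t) (pos D l) d" if d: "d < 4" for d
  proof -
    define y where "y = padd (pos D l) (eps d)"
    have ad: "adjacent (pos D l) y" unfolding y_def by (rule padd_eps_adjacent[OF d])
    then have mem: "y \<in> cells E \<longleftrightarrow> y \<in> cells D" using pl(2) bc_eq_iff by blast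
    have "run A (cells E) t y = run A (cells D) t y" if yD: "y \<in> cells D"
    proof -
      obtain k where k: "k \<in> {lo D..hi D}" "y = pos D k" "\<bar>l - k\<bar> = 1"
        using yD ad config_adjacent_iff[OF D lD(1)] unfolding cells_def by blast
      obtain k' where k': "k' \<in> {lo E..hi E}" "y = pos E k'" "\<bar>l - k'\<bar> = 1"
        using yD mem ad pl config_adjacent_iff[OF E lD(2)] unfolding cells_def by (metis imageE)
      show ?thesis
      proof (cases "k \<in> {i..j}")
        case True
        have c: "i = lo D \<or> int t < k - 2 * (i - 1)" "j = hi D \<or> int t < 2 * (j + 1) - k"
          using Suc.prems(2,3) k(3) by auto
        show ?thesis using Suc.IH[OF True c] k(2) by simp
      next
        case False
        have nk': "k' \<notin> {i..j}"
        proof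
          assume "k' \<in> {i..j}"
          moreover from this have "pos D k' = pos D k" using ag k k' unfolding agree_def by simp
          ultimately show False using config_inj[OF D _ k(1), of k'] False ag unfolding agree_def by auto
        qed
        \<comment> \<open>Outside the segment the same cell may have different indices in
          \<open>D\<close> and \<open>E\<close>, but in both runs it is still quiescent.\<close>
        have "int t < \<bar>k\<bar>" "int t < \<bar>k'\<bar>"
          using False nk' Suc.prems k k' ij by auto
        then show ?thesis using run_quiescent[OF A D k(1)] run_quiescent[OF A E k'(1)] k(2) k'(2) by metis
      qed
    qed
    then show ?thesis unfolding nbr_def y_def[symmetric] using mem by simp
  qed
  moreover have "run A (cells E) t (pos D l) = run A (cells D) t (pos D l)"
    using Suc.prems by (intro Suc.IH) auto
  ultimately show ?case by simp
qed

text \<open>A single observer \<open>l\<close> suffices, since in each configuration all nodes fire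
  together for the first time.\<close>

lemma ft_agree:
  assumes A: "is_solution A" and D: "is_config D" and E: "is_config E" and ag: "agree D E i j"
    and l: "l \<in> {i..j}" "i = lo D \<or> int (ft D A) < l - 2 * (i - 1)" "j = hi D \<or> int (ft D A) < 2 * (j + 1) - l"
  shows "ft E A = ft D A"
proof -
  have aut: "is_automaton A" using A unfolding is_solution_def by blast
  have eq: "run A (cells E) t (pos D l) = run A (cells D) t (pos D l)" if "t \<le> ft D A" for t
    using that l by (intro run_agree[OF aut D E ag]) auto
  have x: "pos D l \<in> cells D" using l(1) ag by (intro pos_in_cells) (auto simp: agree_def)
  have "pos E l \<in> cells E" using l(1) ag by (intro pos_in_cells) (auto simp: agree_def)
  then have y: "pos D l \<in> cells E" using l(1) ag unfolding agree_def by simp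
  note fD = fires_at_ft[OF A D, unfolded fires_at_def] and fE = fires_at_ft[OF A E, unfolded fires_at_def]
  have "\<not> ft E A < ft D A" using fD fE x y eq[of "ft E A"] by auto
  moreover have "\<not> ft D A < ft E A" using fD fE x y eq[OF order_refl] by metis
  ultimately show ?thesis by simp
qed

lemma ft_ge:
  assumes A: "is_solution A" and D: "is_config D" and l: "l \<in> {lo D..hi D}"
  shows "\<bar>l\<bar> \<le> int (ft D A)"
proof (rule ccontr)
  assume "\<not> \<bar>l\<bar> \<le> int (ft D A)"
  then have "run A (cells D) (ft D A) (pos D l) = quiescent A"
    using A run_quiescent[OF _ D l] unfolding is_solution_def by simp
  then have "quiescent A \<in> firing A"
    using fires_at_ft[OF A D] pos_in_cells[OF l] unfolding fires_at_def by metis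
  then show False using A unfolding is_solution_def is_automaton_def by blast
qed

section \<open>Extensions at the left end\<close>

lemma W_D:
  assumes "(x0, x1) \<in> W C i j"
  shows "is_config (extend C i j x0 x1)"
    "l \<in> {i..j} \<Longrightarrow> bc (cells (extend C i j x0 x1)) (pos C l) = bc (cells C) (pos C l)"
  using assms unfolding W_def by auto

lemma extend_simps:
  "lo (extend C i j x0 x1) = i - int (length x0)" "hi (extend C i j x0 x1) = j + int (length x1)"
  "i \<le> l \<Longrightarrow> l \<le> j \<Longrightarrow> pos (extend C i j x0 x1) l = pos C l"
  "l < i \<Longrightarrow> pos (extend C i j x0 x1) l = x0 ! nat (l - (i - int (length x0)))"
  "i \<le> l \<Longrightarrow> j < l \<Longrightarrow> pos (extend C i j x0 x1) l = x1 ! nat (l - j - 1)"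
  unfolding extend_def by simp_all

lemma agree_extend:
  assumes "is_config C" "in_range C i j" "(x0, x1) \<in> W C i j"
  shows "agree C (extend C i j x0 x1) i j"
  using W_D(2)[OF assms(3)] assms(2) unfolding agree_def in_range_def by (simp add: extend_simps)

text \<open>An end of \<open>C\<close> has at most one neighbour, and its code carries this over to
  \<open>E\<close>.\<close>

lemma endpoint_agree:
  assumes C: "is_config C" and E: "is_config E" and l: "l \<in> {lo C..hi C}" "l \<in> {lo E..hi E}"
    and p: "pos E l = pos C l" "bc (cells E) (pos C l) = bc (cells C) (pos C l)"
    and e: "l = lo C \<or> l = hi C"
  shows "l = lo E \<or> l = hi E"
proof (rule ccontr)
  assume "\<not> (l = lo E \<or> l = hi E)"
  then have r: "l - 1 \<in> {lo E..hi E}" "l + 1 \<in> {lo E..hi E}" using l by auto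
  define k where "k = (if l = lo C then l + 1 else l - 1)"
  have "pos E m = pos C k" if "m \<in> {lo E..hi E}" "\<bar>l - m\<bar> = 1" for m
  proof -
    have ad: "adjacent (pos C l) (pos E m)" using config_adjacent_iff[OF E l(2) that(1)] that(2) p(1) by simp
    then have "pos E m \<in> cells C" using p(2) pos_in_cells[OF that(1)] bc_eq_iff by blast
    from adjacent_cell[OF C l(1) this ad] show ?thesis using e unfolding k_def by (smt (verit))
  qed
  then have "pos E (l - 1) = pos E (l + 1)" using r by simp
  then show False using config_inj[OF E r] by simp
qed

text \<open>The hypothesis \<open>ne\<close> excludes the degenerate extension in which
  \<open>p_s\<close> becomes the left end, so that its only neighbour could lie on the
  right.\<close>

lemma V_right_end:
  assumes C: "is_config C" and W: "(x0, x1) \<in> W C i (hi C)" and i: "in_range C i (hi C)"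
    and ne: "i - int (length x0) < hi C \<or> lo C = hi C"
  shows "x1 = []"
proof (rule ccontr)
  assume x1: "x1 \<noteq> []"
  define E where "E = extend C i (hi C) x0 x1"
  have E: "is_config E" using W_D(1)[OF W] unfolding E_def .
  have ag: "agree C E i (hi C)" using agree_extend[OF C i W] unfolding E_def .
  have hE: "hi E > hi C" using x1 unfolding E_def extend_simps by simp
  have r: "hi C \<in> {lo C..hi C}" "hi C \<in> {lo E..hi E}" using ag hE unfolding agree_def by auto
  have p: "pos E (hi C) = pos C (hi C)" "bc (cells E) (pos C (hi C)) = bc (cells C) (pos C (hi C))"
    using ag unfolding agree_def by auto
  show False
  proof (cases "lo E < hi C")
    case True
    then show False using endpoint_agree[OF C E r p] hE by auto
  next
    case False
    then have lC: "lo C = hi C" using ne unfolding E_def extend_simps by auto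
    have m: "hi C + 1 \<in> {lo E..hi E}" using hE r by auto
    have ad: "adjacent (pos C (hi C)) (pos E (hi C + 1))"
      using config_adjacent_iff[OF E r(2) m] p(1) by simp
    then have "pos E (hi C + 1) \<in> cells C" using p(2) pos_in_cells[OF m] bc_eq_iff by blast
    then show False by (rule adjacent_cell[OF C r(1) _ ad]) (use lC in simp_all)
  qed
qed

lemma U_left_end:
  assumes C: "is_config C" and W: "(x0, x1) \<in> W C (lo C) j" and j: "in_range C (lo C) j"
    and ne: "lo C < j + int (length x1)"
  shows "x0 = []"
proof (rule ccontr)
  assume x0: "x0 \<noteq> []"
  define E where "E = extend C (lo C) j x0 x1"
  have E: "is_config E" using W_D(1)[OF W] unfolding E_def .
  have ag: "agree C E (lo C) j" using agree_extend[OF C j W] unfolding E_def .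
  have "lo E < lo C" "lo C < hi E" using x0 ne unfolding E_def extend_simps by simp_all
  moreover have "lo C \<in> {lo C..hi C}" "lo C \<in> {lo E..hi E}" using ag unfolding agree_def by auto
  ultimately show False using endpoint_agree[OF C E, of "lo C"] ag unfolding agree_def by auto
qed

text \<open>The configuration is unchanged: cells pass from the fixed segment into the right
  extension, and fewer codes are prescribed.\<close>

lemma W_shift_right:
  assumes W: "(x0, x1) \<in> W C i j" and j: "j' \<le> j"
  shows "(x0, map (pos C) [j'+1..j] @ x1) \<in> W C i j'"
proof -
  let ?D = "extend C i j x0 x1" and ?E = "extend C i j' x0 (map (pos C) [j'+1..j] @ x1)"
  have "pos ?E l = pos ?D l" if "lo ?D \<le> l" "l \<le> hi ?D" for l
    using that j unfolding extend_def by (auto simp: nth_append nat_less_iff) (smt (verit) nat_diff_distrib')+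
  then have "is_config ?E" "cells ?E = cells ?D"
    using is_config_cong[OF W_D(1)[OF W], of ?E] j by (auto simp: extend_simps)
  then show ?thesis using W_D(2)[OF W] j unfolding W_def by auto
qed

lemma W_shift_left:
  assumes W: "([], x1) \<in> W C i j" and i: "i \<le> j"
  shows "([pos C i], x1) \<in> W C (i+1) j"
proof -
  let ?D = "extend C i j [] x1" and ?E = "extend C (i+1) j [pos C i] x1"
  have "pos ?E l = pos ?D l" if "lo ?D \<le> l" "l \<le> hi ?D" for l
    using that i unfolding extend_def by auto
  then have "is_config ?E" "cells ?E = cells ?D"
    using is_config_cong[OF W_D(1)[OF W], of ?E] by (auto simp: extend_simps)
  then show ?thesis using W_D(2)[OF W] unfolding W_def by auto
qed

lemma W_self:
  assumes C: "is_config C" and j: "in_range C (lo C) j"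
  shows "([], map (pos C) [j+1..hi C]) \<in> W C (lo C) j"
  using agree_W[OF C C refl] j unfolding agree_def in_range_def by simp

text \<open>The left components are empty, and the right ones have bounded length with positions in
  a bounded box.\<close>

lemma finite_W_left_end:
  assumes C: "is_config C" and j: "in_range C (lo C) j" and left: "lo C < 0"
    and g: "g C (lo C) j \<noteq> \<infinity>"
  shows "finite (W C (lo C) j)"
proof -
  obtain n where n: "g C (lo C) j = enat n" using g by auto
  define B where "B = box (nat j + n)"
  have "finite ({[]} \<times> {xs. set xs \<subseteq> B \<and> length xs \<le> n})"
    unfolding B_def box_def by (intro finite_cartesian_product finite_lists_length_le) auto
  moreover have "W C (lo C) j \<subseteq> {[]} \<times> {xs. set xs \<subseteq> B \<and> length xs \<le> n}"
  proof
    fix w assume w: "w \<in> W C (lo C) j"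
    obtain x0 x1 where w': "w = (x0, x1)" by (cases w)
    have W: "(x0, x1) \<in> W C (lo C) j" using w w' by simp
    have len: "length x1 \<le> n" using length_le_g[OF W] n by simp
    have j0: "0 \<le> j" using j unfolding in_range_def by simp
    then have x0: "x0 = []" using U_left_end[OF C W j] left by simp
    have "x \<in> B" if x: "x \<in> set x1" for x
    proof -
      obtain k where k: "k < length x1" "x = x1 ! k" using x by (metis in_set_conv_nth)
      let ?E = "extend C (lo C) j x0 x1" and ?l = "j + 1 + int k"
      have l: "?l \<in> {lo ?E..hi ?E}" using k j0 left by (simp add: extend_simps)
      have "pos ?E ?l = x" using k j0 left by (simp add: extend_simps)
      then have "\<bar>fst x\<bar> \<le> j + int n" "\<bar>snd x\<bar> \<le> j + int n"
        using pos_bound[OF W_D(1)[OF W] l] k(1) len j0 by auto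
      then show ?thesis using j0 unfolding B_def box_def mem_Times_iff by auto
    qed
    then show "w \<in> {[]} \<times> {xs. set xs \<subseteq> B \<and> length xs \<le> n}" using w' x0 len by auto
  qed
  ultimately show ?thesis by (rule rev_finite_subset)
qed

text \<open>Freeness gives long left extensions of the segment up to \<open>hi C\<close>; as the
  right end of \<open>C\<close> cannot be extended, shortening the segment to \<open>j\<close> moves
  only cells of \<open>C\<close> into \<open>x1\<close>.\<close>

lemma free_left_extensions:
  assumes C: "is_config C" and free: "free_left_hand C" and left: "lo C < 0" and j: "in_range C (lo C) j"
  obtains x0 x1 where "(x0, []) \<in> W C (lo C + 1) (hi C)" "(x0, x1) \<in> W C (lo C + 1) j" "N < length x0"
proof -
  have "enat (N + 1) < f C (lo C + 1) (hi C)" using free left unfolding free_left_hand_def by simp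
  then obtain x0 where x0: "x0 \<in> U C (lo C + 1) (hi C)" "enat (N + 1) < enat (length x0)"
    unfolding f_def less_SUP_iff by blast
  then obtain y where y: "(x0, y) \<in> W C (lo C + 1) (hi C)" unfolding U_def by auto
  have jr: "0 \<le> hi C" "j \<le> hi C" "in_range C (lo C + 1) (hi C)"
    using j left unfolding in_range_def by auto
  have "y = []" using V_right_end[OF C y jr(3)] x0(2) jr left by simp
  then show thesis using that[of x0] y W_shift_right[OF y jr(2)] x0(2) by simp
qed

lemma infinite_W_left:
  assumes C: "is_config C" and free: "free_left_hand C" and left: "lo C < 0" and j: "in_range C (lo C) j"
  shows "infinite (W C (lo C + 1) j)"
proof
  assume fin: "finite (W C (lo C + 1) j)"
  define N where "N = Max ((\<lambda>(x0, x1). length x0) ` W C (lo C + 1) j)"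
  obtain x0 x1 where x: "(x0, x1) \<in> W C (lo C + 1) j" "N < length x0"
    using free_left_extensions[OF C free left j, of N] by metis
  then have "length x0 \<le> N" unfolding N_def using fin by (intro Max_ge) force+
  then show False using x by simp
qed

lemma bc_local:
  assumes D: "is_config D" and E: "is_config E" and l: "lo D < l" "lo E < l" "l \<le> hi D" "hi E = hi D"
    and p: "pos E (l-1) = pos D (l-1)" "pos E l = pos D l" "l < hi D \<Longrightarrow> pos E (l+1) = pos D (l+1)"
  shows "bc (cells E) (pos D l) = bc (cells D) (pos D l)"
proof -
  have r: "l \<in> {lo D..hi D}" "l \<in> {lo E..hi E}" "l - 1 \<in> {lo D..hi D}" "l - 1 \<in> {lo E..hi E}" using l by auto
  have r': "l + 1 \<in> {lo D..hi D}" "l + 1 \<in> {lo E..hi E}" if "l < hi D" using l that by auto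
  show ?thesis unfolding bc_eq_iff
  proof (intro allI impI iffI)
    fix y assume ad: "adjacent (pos D l) y" and y: "y \<in> cells E"
    have "adjacent (pos E l) y" using ad p(2) by simp
    from adjacent_cell[OF E r(2) y this] show "y \<in> cells D"
      using p l(4) r(3) r'(1) pos_in_cells[of _ D] by (metis add1_zle_eq)
  next
    fix y assume ad: "adjacent (pos D l) y" and y: "y \<in> cells D"
    from adjacent_cell[OF D r(1) y ad] show "y \<in> cells E"
      using p l(4) r(4) r'(2) pos_in_cells[of _ E] by (metis add1_zle_eq)
  qed
qed

text \<open>\<open>hi C - 2 * lo C\<close> is the first time at which the right end can see the left
  end. Before it, a left extension too long to be awake by time \<open>T\<close> would have to fire
  as well.\<close>

lemma ft_gt_whole:
  assumes C: "is_config C" and free: "free_left_hand C" and left: "lo C < 0" and A: "is_solution A"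
    and T: "int T < hi C - 2 * lo C"
  shows "T < ft C A"
proof (rule ccontr)
  assume "\<not> T < ft C A"
  then have le: "ft C A \<le> T" by simp
  have j: "in_range C (lo C) (hi C)" "in_range C (lo C + 1) (hi C)"
    using config_zero[OF C] left unfolding in_range_def by auto
  obtain x0 where x0: "(x0, []) \<in> W C (lo C + 1) (hi C)" "T < length x0"
    using free_left_extensions[OF C free left j(1), of T] by metis
  let ?E = "extend C (lo C + 1) (hi C) x0 []"
  have E: "is_config ?E" using W_D(1)[OF x0(1)] .
  have "ft ?E A = ft C A"
    using ft_agree[OF A C E agree_extend[OF C j(2) x0(1)], of "hi C"] le T left j unfolding in_range_def by simp
  moreover have "\<bar>lo ?E\<bar> \<le> int (ft ?E A)" using config_zero[OF E] by (intro ft_ge[OF A E]) auto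
  ultimately show False using le x0(2) left by (simp add: extend_simps)
qed

text \<open>The right end of the extension \<open>p\<^sub>r \<dots> p\<^sub>j x1\<close> does not see \<open>p\<^sub>r\<close> by time \<open>T\<close>; noninterference
  then supplies an equally timed extension whose left end is out of reach.\<close>
lemma ft_gt_known:
  assumes C: "is_config C" and free: "free_left_hand C" and cni: "CNI C" and A: "is_solution A"
    and j: "in_range C (lo C) j"
    and T: "int T < 2 * j + 2 - lo C"
      "int T < j - 2 * lo C \<or> enat (nat (int T - j + 2 * lo C)) < g C (lo C) j"
  shows "T < ft C A"
proof (rule ccontr)
  assume "\<not> T < ft C A"
  then have le: "ft C A \<le> T" by simp
  have r0: "lo C \<le> 0" "0 \<le> j" "j \<le> hi C" using j unfolding in_range_def by auto
  \<comment> \<open>\<open>x1\<close> puts the right end out of sight of the left end; when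
    \<open>g\<close> is infinite, even out of reach of the general by time \<open>T\<close>. If
    \<open>T < j - 2 * lo C\<close>, the cells of \<open>C\<close> itself serve.\<close>
  have "\<exists>x0 x1. (x0, x1) \<in> W C (lo C) j \<and> int T < j + int (length x1) - 2 * lo C \<and>
     (g C (lo C) j = \<infinity> \<longrightarrow> int T < j + int (length x1))"
  proof (cases "g C (lo C) j = \<infinity>")
    case True
    then have "enat T < g C (lo C) j" by simp
    then obtain x1 where "x1 \<in> V C (lo C) j" "enat T < enat (length x1)" unfolding g_def less_SUP_iff by blast
    then show ?thesis using r0 unfolding V_def by force
  next
    case False
    show ?thesis
    proof (cases "int T < j - 2 * lo C")
      case True
      then show ?thesis using False W_self[OF C j] r0 by (intro exI conjI) auto
    next
      case ge: False
      then obtain x1 where "x1 \<in> V C (lo C) j" "enat (nat (int T - j + 2 * lo C)) < enat (length x1)"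
        using T(2) unfolding g_def less_SUP_iff by blast
      then show ?thesis using False ge unfolding V_def by force
    qed
  qed
  then obtain x0 x1 where x: "(x0, x1) \<in> W C (lo C) j" "int T < j + int (length x1) - 2 * lo C"
    "g C (lo C) j = \<infinity> \<longrightarrow> int T < j + int (length x1)" by (elim exE conjE) (rule that)
  have "lo C < j + int (length x1)" using x(2) r0 by auto
  then have "x0 = []" using U_left_end[OF C x(1) j] by blast
  then have W: "([], x1) \<in> W C (lo C) j" using x by simp
  define D where "D = extend C (lo C) j [] x1"
  have D: "is_config D" using W_D(1)[OF W] unfolding D_def .
  have hD: "hi D = j + int (length x1)" "lo D = lo C" unfolding D_def by (simp_all add: extend_simps)
  \<comment> \<open>First transfer, observed at the left end, which does not see beyond
    \<open>j\<close>.\<close>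
  have ftD: "ft D A = ft C A"
    using ft_agree[OF A C D, of "lo C" j "lo C"] agree_extend[OF C j W] r0 le T(1) unfolding D_def by simp
  have "\<bar>hi D\<bar> \<le> int (ft D A)" using config_zero[OF D] by (intro ft_ge[OF A D]) auto
  \<comment> \<open>All of \<open>D\<close> fires by time \<open>T\<close>, so its right end has
    been reached; this rules out both \<open>lo C = 0\<close> and infinite \<open>g\<close>.\<close>
  then have hT: "hi D \<le> int T" using ftD le by simp
  then have left: "lo C < 0" using x(2) hD r0 by (cases "lo C = 0") auto
  have "g C (lo C) j \<noteq> \<infinity>" using x(3) hT hD by auto
  then have "finite (W C (lo C) j)" by (rule finite_W_left_end[OF C j left])
  then have "(lo C + 1, j) \<in> Iset C"
    using infinite_W_left[OF C free left j] j left unfolding Iset_def in_range_def by simp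
  then have NI: "NI C (lo C + 1) j" using cni unfolding CNI_def by blast
  obtain z y where z: "(z, y) \<in> W C (lo C + 1) j" "T < length z"
    using free_left_extensions[OF C free left j, of T] by metis
  have "([pos C (lo C)], x1) \<in> W C (lo C + 1) j" using W_shift_left[OF W] r0 by simp
  then have x1V: "x1 \<in> V C (lo C + 1) j" unfolding V_def by force
  have "z \<in> U C (lo C + 1) j" using z(1) unfolding U_def by force
  \<comment> \<open>Noninterference combines the long left part \<open>z\<close> with
    \<open>x1\<close>, although the two come from different extensions.\<close>
  then have WE: "(z, x1) \<in> W C (lo C + 1) j" using NI x1V unfolding NI_def by simp
  define E where "E = extend C (lo C + 1) j z x1"
  have E: "is_config E" using W_D(1)[OF WE] unfolding E_def .
  have hE: "hi E = hi D" "lo E = lo C + 1 - int (length z)" using hD unfolding E_def by (simp_all add: extend_simps)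
  have p: "pos E l = pos D l" if "lo C + 1 \<le> l" for l
    using that unfolding D_def E_def extend_def by simp
  \<comment> \<open>Up to \<open>j\<close> both codes are those of \<open>C\<close>; beyond
    \<open>j\<close> they depend only on consecutive cells, which coincide.\<close>
  have "bc (cells E) (pos D l) = bc (cells D) (pos D l)" if l: "lo C + 1 \<le> l" "l \<le> hi D" for l
  proof (cases "l \<le> j")
    case True
    then have "pos D l = pos C l" using l unfolding D_def by (simp add: extend_simps)
    then show ?thesis using W_D(2)[OF WE, of l] W_D(2)[OF W, of l] True l unfolding E_def D_def by simp
  next
    case False
    then show ?thesis using l hD hE p r0 left by (intro bc_local[OF D E]) auto
  qed
  then have ag: "agree D E (lo C + 1) (hi D)"
    using p hE hD left r0 unfolding agree_def by auto
  \<comment> \<open>Second transfer, observed at the right end, which does not see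
    \<open>lo C\<close>.\<close>
  have "ft E A = ft D A"
    using ft_agree[OF A D E ag, of "hi D"] x(2) hD left r0 le ftD by simp
  moreover have "\<bar>lo E\<bar> \<le> int (ft E A)" using config_zero[OF E] by (intro ft_ge[OF A E]) auto
  ultimately show False using le z(2) left hE ftD by simp
qed

theorem theorem13:
  fixes C :: config
  assumes "is_config C" and "free_left_hand C" and "CNI C"
  defines "j0 \<equiv> LEAST j. 0 \<le> j \<and> j \<le> hi C \<and>
                   enat (nat (- lo C)) + g C (lo C) j \<le> enat (nat (j + 1))"
  shows "(- lo C > hi C \<longrightarrow> int (mft C) = - 2 * lo C + hi C) \<and>
         (- lo C \<le> hi C \<and> enat (nat (- lo C)) + g C (lo C) j0 = enat (nat (j0 + 1))
            \<longrightarrow> int (mft C) = - lo C + 2 * j0 + 1) \<and>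
         (- lo C \<le> hi C \<and> enat (nat (- lo C)) + g C (lo C) j0 < enat (nat (j0 + 1))
            \<longrightarrow> int (mft C) = - lo C + 2 * j0)"
proof -
  note C = assms(1)
  note z = config_zero[OF C]
  define a where "a = nat (- lo C)"
  have a: "lo C = - int a" using z unfolding a_def by simp
  \<comment> \<open>Supplies the upper bound when \<open>- lo C > hi C\<close> and, otherwise, the
    existence of \<open>j0\<close>.\<close>
  have g_end: "g C (lo C) (hi C) = 0"
  proof -
    have "x = []" if "x \<in> V C (lo C) (hi C)" for x
      using that z V_right_end[OF C, of _ x "lo C"] unfolding V_def in_range_def by force
    then have "enat (length x) = 0" if "x \<in> V C (lo C) (hi C)" for x using that by (simp add: zero_enat_def)
    then show ?thesis unfolding g_def by (metis (no_types, lifting) SUP_least le_zero_eq order_refl)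
  qed
  have bound: "mft C \<le> T" if "0 \<le> j" "j \<le> hi C" "2 * j + int a \<le> int T"
    "\<And>n. enat n \<le> g C (lo C) j \<Longrightarrow> j + int n + 2 * int a \<le> int T" for j T
  proof (rule mft_le_known[OF C that(1,2)])
    show "2 * j - lo C \<le> int T" using that(3) a by simp
    show "h - 2 * lo C \<le> int T" if "j \<le> h" "enat (nat (h - j)) \<le> g C (lo C) j" for h
      using \<open>\<And>n. enat n \<le> g C (lo C) j \<Longrightarrow> j + int n + 2 * int a \<le> int T\<close>[OF that(2)] that(1) a by simp
  qed
  have case1: "int (mft C) = - 2 * lo C + hi C" if "- lo C > hi C"
  proof -
    have left: "lo C < 0" using that z by simp
    define T where "T = nat (- 2 * lo C + hi C)"
    have T: "int T = 2 * int a + hi C" using a z unfolding T_def by simp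
    have "mft C \<le> T" using that z T a g_end by (intro bound[of "hi C"]) (auto simp: zero_enat_def)
    moreover have "T \<le> mft C"
    proof (rule mft_geI)
      fix A assume "is_solution A"
      then have "T - 1 < ft C A" using T a left z by (intro ft_gt_whole[OF C assms(2) left]) auto
      then show "T \<le> ft C A" by simp
    qed
    ultimately show ?thesis using T a by simp
  qed
  have case2: "int (mft C) = - lo C + 2 * j0 + (if enat a + g C (lo C) j0 = enat (nat (j0 + 1)) then 1 else 0)"
    if le: "- lo C \<le> hi C"
  proof -
    define P where "P j \<longleftrightarrow> 0 \<le> j \<and> j \<le> hi C \<and> enat a + g C (lo C) j \<le> enat (nat (j + 1))" for j
    have Pend: "P (int (nat (hi C)))" unfolding P_def using z le a g_end by auto
    \<comment> \<open>Admissible indices are nonnegative, so the least integer is found among the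
      naturals, where \<open>LeastI\<close> applies.\<close>
    define n0 where "n0 = (LEAST n. P (int n))"
    have Pn: "P (int n0)" unfolding n0_def using LeastI[of "\<lambda>n. P (int n)", OF Pend] .
    have least: "n0 \<le> n" if "P (int n)" for n unfolding n0_def using that by (rule Least_le)
    have "j0 = Least P" unfolding j0_def P_def a_def ..
    also have "Least P = int n0"
    proof (rule Least_equality[of P, OF Pn])
      fix y assume y: "P y"
      then have "P (int (nat y))" unfolding P_def by simp
      then show "int n0 \<le> y" using least[of "nat y"] y unfolding P_def by linarith
    qed
    finally have j0: "j0 = int n0" .
    have n0: "int n0 \<le> hi C" "enat a + g C (lo C) (int n0) \<le> enat (n0 + 1)" using Pn nat_int[of "n0 + 1"] unfolding P_def by (simp_all add: add.commute)
    then obtain b where b: "g C (lo C) (int n0) = enat b" by (cases "g C (lo C) (int n0)") auto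
    have ab: "a + b \<le> n0 + 1" using n0(2) b by simp
    define e where "e = (if a + b = n0 + 1 then 1 else (0::nat))"
    define T where "T = a + 2 * n0 + e"
    \<comment> \<open>With \<open>a + b \<le> n0 + e\<close>, the time \<open>n0 + b + 2 * a\<close>
      for the farthest right end is at most \<open>T\<close>.\<close>
    have "mft C \<le> T" using n0(1) b ab by (intro bound[of "int n0"]) (auto simp: T_def e_def)
    moreover have "T \<le> mft C"
    proof (rule mft_geI)
      fix A assume A: "is_solution A"
      show "T \<le> ft C A"
      proof (cases "e = 1")
        case True
        then have eq: "a + b = n0 + 1" unfolding e_def by (simp split: if_splits)
        \<comment> \<open>In the case of equality \<open>T - 1 - n0 - 2 * a = b - 1\<close>, just
          below \<open>g\<close> at \<open>n0\<close>; for \<open>b = 0\<close> the first disjunct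
          applies.\<close>
        have "T - 1 < ft C A"
        proof (rule ft_gt_known[OF C assms(2,3) A, of "int n0"])
          show "in_range C (lo C) (int n0)" using z n0 unfolding in_range_def by simp
          show "int (T - 1) < 2 * int n0 + 2 - lo C" using True a unfolding T_def by simp
          show "int (T - 1) < int n0 - 2 * lo C \<or> enat (nat (int (T - 1) - int n0 + 2 * lo C)) < g C (lo C) (int n0)"
            using True a b eq unfolding T_def by auto
        qed
        then show ?thesis by simp
      next
        case False
        then have e0: "e = 0" unfolding e_def by (simp split: if_splits)
        show ?thesis
        proof (cases n0)
          case 0
          have "\<bar>lo C\<bar> \<le> int (ft C A)" using z by (intro ft_ge[OF A C]) auto
          then show ?thesis using 0 e0 a unfolding T_def by simp
        next
          case (Suc m)
          then have "\<not> P (int m)" using least[of m] by auto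
          \<comment> \<open>Without equality the bound comes from the preceding index
            \<open>m = n0 - 1\<close>, where minimality makes \<open>a + g\<close> exceed
            \<open>m + 1\<close>.\<close>
          then have nP: "\<not> enat a + g C (lo C) (int m) \<le> enat (m + 1)" using n0(1) Suc nat_int[of "m + 1"] unfolding P_def by (simp add: add.commute)
          have "T - 1 < ft C A"
          proof (rule ft_gt_known[OF C assms(2,3) A, of "int m"])
            show "in_range C (lo C) (int m)" using z n0 Suc unfolding in_range_def by simp
            show "int (T - 1) < 2 * int m + 2 - lo C" using e0 a Suc unfolding T_def by simp
            have "int (T - 1) - int m + 2 * lo C = int m + 1 - int a" using e0 a Suc unfolding T_def by simp
            then show "int (T - 1) < int m - 2 * lo C \<or> enat (nat (int (T - 1) - int m + 2 * lo C)) < g C (lo C) (int m)"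
              using a nP by (cases "g C (lo C) (int m)") auto
          qed
          then show ?thesis by simp
        qed
      qed
    qed
    ultimately have "int (mft C) = int T" by simp
    then show ?thesis using a b j0 unfolding T_def e_def by auto
  qed
  show ?thesis using case1 case2 unfolding a_def by auto
qed

end
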